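(* Let $k$ be a field and let $l\ge 2$. With the groups and their elementary matrices as defined in the context, the following hold. ($\mathcal A$) Every element of the orthogonal group $O(d,k)$, i.e. of each of the groups $O^{+}(2l,k)$, $O(2l+1,k)$, $O^{-}(2l,k)$, can be written as a product of elementary matrices of that group and a diagonal matrix. Furthermore, the diagonal matrix is of the form: - $\mathrm{diag}(1,\ldots,1,\lambda,1,\ldots,1,\lambda^{-1})$ with $\lambda\in k^\times$, for $O^{+}(2l,k)$; - $\mathrm{diag}(\vartheta,1,\ldots,1,\lambda,1,\ldots,1,\lambda^{-1})$ with $\lambda\in k^\times$ and $\vartheta=\pm1$, for $O(2l+1,k)$; - $\mathrm{diag}(1,1,\underbrace{1,\ldots,1,\lambda}_{l-1},\underbrace{1,\ldots,1,\lambda^{-1}}_{l-1})$ with $\lambda\in k^\times$, for $O^{-}(2l,k)$. In each case $\lambda$ and $\lambda^{-1}$ are in the positions indexed by $l$ and $-l$ respectively. ($\mathcal B$) Every element of the symplectic group $\mathrm{Sp}(2l,k)$ can be written as a product of elementary matrices of $\mathrm{Sp}(2l,k)$.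
   Context: $I$ is the identity matrix and $e_{a,b}$ is the matrix unit with $1$ in place $(a,b)$ and $0$ elsewhere. Rows and columns are indexed, in this order, by $1,\ldots,l,-1,\ldots,-l$ for $\mathrm{Sp}(2l,k)$ and $O^+(2l,k)$; by $0,1,\ldots,l,-1,\ldots,-l$ for $O(2l+1,k)$; and by $1,-1,2,\ldots,l,-2,\ldots,-l$ for $O^-(2l,k)$. Vectors are column vectors with coordinates $x_a$ indexed accordingly. Groups. - $\mathrm{Sp}(2l,k)=\{g\in GL(2l,k): {}^Tg\beta g=\beta\}$ with $\beta=\begin{pmatrix}0&I_l\\-I_l&0\end{pmatrix}$. - The orthogonal groups are the groups of $g\in GL(d,k)$ with $Q(gx)=Q(x)$ for all $x\in k^d$, where: - $O^+(2l,k)$: $d=2l$ and $Q(x)=x_1x_{-1}+\cdots+x_lx_{-l}$; - $O(2l+1,k)$: $d=2l+1$ and $Q(x)=x_0^2+x_1x_{-1}+\cdots+x_lx_{-l}$; - $O^-(2l,k)$: $d=2l$; if $\mathrm{char}(k)\ne2$, $Q(x)=x_1^2+\epsilon x_{-1}^2+x_2x_{-2}+\cdots+x_lx_{-l}$ with $\epsilon$ a fixed non-square in $k$; if $\mathrm{char}(k)=2$, $Q(x)=\alpha(x_1^2+x_{-1}^2)+x_1x_{-1}+x_2x_{-2}+\cdots+x_lx_{-l}$ with $\alpha\in k$ fixed such that $\alpha T^2+T+\alpha$ is irreducible in $k[T]$. (The group is considered only when such $\epsilon$, respectively $\alpha$, exists.) Elementary matrices ($t$ ranges over $k$). Common matrices,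 for orthogonal groups: $x_{i,j}(t)=I+t(e_{i,j}-e_{-j,-i})$ for $i\ne j$; $x_{i,-j}(t)=I+t(e_{i,-j}-e_{j,-i})$ for $i<j$; $x_{-i,j}(t)=I+t(e_{-i,j}-e_{-j,i})$ for $i<j$. - $O^+(2l,k)$: the common matrices with $1\le i,j\le l$, and $w_i=I-e_{i,i}-e_{-i,-i}+e_{i,-i}+e_{-i,i}$ for $1\le i\le l$. - $O(2l+1,k)$: the common matrices with $1\le i,j\le l$, and for $1\le i\le l$: if $\mathrm{char}(k)\neq2$, $x_{i,0}(t)=I+t(2e_{i,0}-e_{0,-i})-t^2e_{i,-i}$ and $x_{0,i}(t)=I+t(-2e_{-i,0}+e_{0,i})-t^2e_{-i,i}$; if $\mathrm{char}(k)=2$, $x_{i,0}(t)=I+te_{0,-i}+t^2e_{i,-i}$ and $x_{0,i}(t)=I+te_{0,i}+t^2e_{-i,i}$. - $O^-(2l,k)$: the common matrices with $2\le i,j\le l$; $w_i=I-e_{i,i}-e_{-i,-i}+e_{i,-i}+e_{-i,i}$ for $2\le i\le l$; and, with $2\le i\le l$: if $\mathrm{char}(k)\ne 2$, $x_{i,1}(t)=I+t(e_{1,i}-2e_{-i,1})-t^2e_{-i,i}$, $x_{1,i}(t)=I+t(-e_{1,-i}+2e_{i,1})-t^2e_{i,-i}$, $x_{i,-1}(t)=I+t(e_{-1,i}-2\epsilon e_{-i,-1})-\epsilon t^2e_{-i,i}$, $x_{-1,i}(t)=I+t(-e_{-1,-i}+2\epsilon e_{i,-1})-\epsilon t^2e_{i,-i}$,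 $x_1(t,s)=I+(t-1)e_{1,1}-(t+1)e_{-1,-1}+s(e_{-1,1}+\epsilon e_{1,-1})$ for $t,s\in k$ with $t^2+\epsilon s^2=1$, $x_2=I-2e_{-1,-1}$; if $\mathrm{char}(k)=2$, $x_{1,-i}(t)=I+te_{1,-i}+te_{i,-1}+\alpha t^2e_{i,-i}$, $x_{-1,-i}(t)=I+te_{-1,-i}+te_{i,1}+\alpha t^2e_{i,-i}$, $x_{A_0}=I+(t-1)e_{1,1}+(s-1)e_{-1,-1}+pe_{1,-1}+re_{-1,1}$ for $t,s,p,r\in k$ with $ts+pr=1$ and $x_{A_0}\in O^-(2l,k)$. - $\mathrm{Sp}(2l,k)$: $x_{i,j}(t)=I+t(e_{i,j}-e_{-j,-i})$ for $i\neq j$; $x_{i,-j}(t)=I+t(e_{i,-j}+e_{j,-i})$ for $i<j$; $x_{-i,j}(t)=I+t(e_{-i,j}+e_{-j,i})$ for $i<j$; $x_{i,-i}(t)=I+te_{i,-i}$; $x_{-i,i}(t)=I+te_{-i,i}$; with $1\le i,j\le l$. *)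

theory Defs
  imports
    "Jordan_Normal_Form.Matrix"
    "HOL-Computational_Algebra.Polynomial"
    "HOL-Computational_Algebra.Nth_Powers"
begin

text \<open>
  Rows and columns carry signed integer labels. The library's matrices are indexed by
  \<open>0, 1, \<dots>\<close>, so each ordered list of labels is encoded by the function sending a label to its
  position in the list:
  \<^item> \<open>pos_even l\<close> for \<open>1, \<dots>, l, -1, \<dots>, -l\<close> (symplectic and \<open>O\<^sup>+\<close>);
  \<^item> \<open>pos_odd l\<close> for \<open>0, 1, \<dots>, l, -1, \<dots>, -l\<close> (\<open>O(2l+1)\<close>);
  \<^item> \<open>pos_minus l\<close> for \<open>1, -1, 2, \<dots>, l, -2, \<dots>, -l\<close> (\<open>O\<^sup>-\<close>).
  The values on integers that are not labels are irrelevant.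
\<close>

definition pos_even :: "nat \<Rightarrow> int \<Rightarrow> nat" where
  "pos_even l a = (if a > 0 then nat a - 1 else l + nat (- a) - 1)"

definition pos_odd :: "nat \<Rightarrow> int \<Rightarrow> nat" where
  "pos_odd l a = (if a \<ge> 0 then nat a else l + nat (- a))"

definition pos_minus :: "nat \<Rightarrow> int \<Rightarrow> nat" where
  "pos_minus l a =
     (if a = 1 then 0 else if a = -1 then 1
      else if a > 0 then nat a else l + nat (- a) - 1)"

definition mat_unit :: "nat \<Rightarrow> (int \<Rightarrow> nat) \<Rightarrow> int \<Rightarrow> int \<Rightarrow> 'a::field mat" where
  "mat_unit d pos a b = mat d d (\<lambda>(r, c). if r = pos a \<and> c = pos b then 1 else 0)"

abbreviation e_even :: "nat \<Rightarrow> int \<Rightarrow> int \<Rightarrow> 'a::field mat" where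
  "e_even l \<equiv> mat_unit (2 * l) (pos_even l)"

abbreviation e_odd :: "nat \<Rightarrow> int \<Rightarrow> int \<Rightarrow> 'a::field mat" where
  "e_odd l \<equiv> mat_unit (2 * l + 1) (pos_odd l)"

abbreviation e_minus :: "nat \<Rightarrow> int \<Rightarrow> int \<Rightarrow> 'a::field mat" where
  "e_minus l \<equiv> mat_unit (2 * l) (pos_minus l)"


section \<open>Groups\<close>

definition GL :: "nat \<Rightarrow> 'a::field mat set" where
  "GL d = {g \<in> carrier_mat d d. invertible_mat g}"

definition symp_form :: "nat \<Rightarrow> 'a::field mat" where
  "symp_form l = four_block_mat (0\<^sub>m l l) (1\<^sub>m l) (- 1\<^sub>m l) (0\<^sub>m l l)"

definition Sp :: "nat \<Rightarrow> 'a::field mat set" where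
  "Sp l = {g \<in> GL (2 * l). transpose_mat g * symp_form l * g = symp_form l}"

definition orth_group :: "nat \<Rightarrow> ('a::field vec \<Rightarrow> 'a) \<Rightarrow> 'a mat set" where
  "orth_group d Q = {g \<in> GL d. \<forall>x \<in> carrier_vec d. Q (g *\<^sub>v x) = Q x}"

definition Q_plus :: "nat \<Rightarrow> 'a::field vec \<Rightarrow> 'a" where
  "Q_plus l x = (\<Sum>i = 1..int l. x $ pos_even l i * x $ pos_even l (- i))"

definition Q_odd :: "nat \<Rightarrow> 'a::field vec \<Rightarrow> 'a" where
  "Q_odd l x = (x $ pos_odd l 0)\<^sup>2 + (\<Sum>i = 1..int l. x $ pos_odd l i * x $ pos_odd l (- i))"

text \<open>
  For \<open>O\<^sup>-\<close> there are two forms: the one with parameter \<open>\<epsilon>\<close> is used in characteristic different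
  from 2, the one with parameter \<open>\<alpha>\<close> (names ending in \<open>2\<close>) in characteristic 2.
\<close>

definition Q_minus :: "nat \<Rightarrow> 'a::field \<Rightarrow> 'a vec \<Rightarrow> 'a" where
  "Q_minus l \<epsilon> x = (x $ pos_minus l 1)\<^sup>2 + \<epsilon> * (x $ pos_minus l (- 1))\<^sup>2
     + (\<Sum>i = 2..int l. x $ pos_minus l i * x $ pos_minus l (- i))"

definition Q_minus2 :: "nat \<Rightarrow> 'a::field \<Rightarrow> 'a vec \<Rightarrow> 'a" where
  "Q_minus2 l \<alpha> x = \<alpha> * ((x $ pos_minus l 1)\<^sup>2 + (x $ pos_minus l (- 1))\<^sup>2)
     + x $ pos_minus l 1 * x $ pos_minus l (- 1)
     + (\<Sum>i = 2..int l. x $ pos_minus l i * x $ pos_minus l (- i))"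

definition O_plus :: "nat \<Rightarrow> 'a::field mat set" where
  "O_plus l = orth_group (2 * l) (Q_plus l)"

definition O_odd :: "nat \<Rightarrow> 'a::field mat set" where
  "O_odd l = orth_group (2 * l + 1) (Q_odd l)"

definition O_minus :: "nat \<Rightarrow> 'a::field \<Rightarrow> 'a mat set" where
  "O_minus l \<epsilon> = orth_group (2 * l) (Q_minus l \<epsilon>)"

definition O_minus2 :: "nat \<Rightarrow> 'a::field \<Rightarrow> 'a mat set" where
  "O_minus2 l \<alpha> = orth_group (2 * l) (Q_minus2 l \<alpha>)"


section \<open>Elementary matrices\<close>

text \<open>
  Matrices common to the orthogonal groups, of size \<open>d\<close>, with matrix units \<open>e\<close> and positive
  labels ranging over \<open>J\<close>.
\<close>

inductive_set elem_common :: "nat \<Rightarrow> (int \<Rightarrow> int \<Rightarrow> 'a::field mat) \<Rightarrow> int set \<Rightarrow> 'a mat set"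
  for d e J where
  pos_pos: "\<lbrakk>i \<in> J; j \<in> J; i \<noteq> j\<rbrakk> \<Longrightarrow>
    1\<^sub>m d + t \<cdot>\<^sub>m (e i j - e (- j) (- i)) \<in> elem_common d e J"
| pos_neg: "\<lbrakk>i \<in> J; j \<in> J; i < j\<rbrakk> \<Longrightarrow>
    1\<^sub>m d + t \<cdot>\<^sub>m (e i (- j) - e j (- i)) \<in> elem_common d e J"
| neg_pos: "\<lbrakk>i \<in> J; j \<in> J; i < j\<rbrakk> \<Longrightarrow>
    1\<^sub>m d + t \<cdot>\<^sub>m (e (- i) j - e (- j) i) \<in> elem_common d e J"

definition w_mat :: "nat \<Rightarrow> (int \<Rightarrow> int \<Rightarrow> 'a::field mat) \<Rightarrow> int \<Rightarrow> 'a mat" where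
  "w_mat d e i = 1\<^sub>m d - e i i - e (- i) (- i) + e i (- i) + e (- i) i"

inductive_set elem_O_plus :: "nat \<Rightarrow> 'a::field mat set" for l where
  common: "g \<in> elem_common (2 * l) (e_even l) {1..int l} \<Longrightarrow> g \<in> elem_O_plus l"
| w: "i \<in> {1..int l} \<Longrightarrow> w_mat (2 * l) (e_even l) i \<in> elem_O_plus l"

inductive_set elem_O_odd :: "nat \<Rightarrow> 'a::field mat set" for l where
  common: "g \<in> elem_common (2 * l + 1) (e_odd l) {1..int l} \<Longrightarrow> g \<in> elem_O_odd l"
| x_i_0: "\<lbrakk>CHAR('a) \<noteq> 2; i \<in> {1..int l}\<rbrakk> \<Longrightarrow>
    1\<^sub>m (2 * l + 1) + t \<cdot>\<^sub>m (2 \<cdot>\<^sub>m e_odd l i 0 - e_odd l 0 (- i))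
      - t\<^sup>2 \<cdot>\<^sub>m e_odd l i (- i) \<in> elem_O_odd l"
| x_0_i: "\<lbrakk>CHAR('a) \<noteq> 2; i \<in> {1..int l}\<rbrakk> \<Longrightarrow>
    1\<^sub>m (2 * l + 1) + t \<cdot>\<^sub>m (- 2 \<cdot>\<^sub>m e_odd l (- i) 0 + e_odd l 0 i)
      - t\<^sup>2 \<cdot>\<^sub>m e_odd l (- i) i \<in> elem_O_odd l"
| x_i_0_char2: "\<lbrakk>CHAR('a) = 2; i \<in> {1..int l}\<rbrakk> \<Longrightarrow>
    1\<^sub>m (2 * l + 1) + t \<cdot>\<^sub>m e_odd l 0 (- i) + t\<^sup>2 \<cdot>\<^sub>m e_odd l i (- i) \<in> elem_O_odd l"
| x_0_i_char2: "\<lbrakk>CHAR('a) = 2; i \<in> {1..int l}\<rbrakk> \<Longrightarrow>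
    1\<^sub>m (2 * l + 1) + t \<cdot>\<^sub>m e_odd l 0 i + t\<^sup>2 \<cdot>\<^sub>m e_odd l (- i) i \<in> elem_O_odd l"

inductive_set elem_O_minus :: "nat \<Rightarrow> 'a::field \<Rightarrow> 'a mat set" for l \<epsilon> where
  common: "g \<in> elem_common (2 * l) (e_minus l) {2..int l} \<Longrightarrow> g \<in> elem_O_minus l \<epsilon>"
| w: "i \<in> {2..int l} \<Longrightarrow> w_mat (2 * l) (e_minus l) i \<in> elem_O_minus l \<epsilon>"
| x_i_1: "i \<in> {2..int l} \<Longrightarrow>
    1\<^sub>m (2 * l) + t \<cdot>\<^sub>m (e_minus l 1 i - 2 \<cdot>\<^sub>m e_minus l (- i) 1)
      - t\<^sup>2 \<cdot>\<^sub>m e_minus l (- i) i \<in> elem_O_minus l \<epsilon>"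
| x_1_i: "i \<in> {2..int l} \<Longrightarrow>
    1\<^sub>m (2 * l) + t \<cdot>\<^sub>m (- e_minus l 1 (- i) + 2 \<cdot>\<^sub>m e_minus l i 1)
      - t\<^sup>2 \<cdot>\<^sub>m e_minus l i (- i) \<in> elem_O_minus l \<epsilon>"
| x_i_m1: "i \<in> {2..int l} \<Longrightarrow>
    1\<^sub>m (2 * l) + t \<cdot>\<^sub>m (e_minus l (- 1) i - (2 * \<epsilon>) \<cdot>\<^sub>m e_minus l (- i) (- 1))
      - (\<epsilon> * t\<^sup>2) \<cdot>\<^sub>m e_minus l (- i) i \<in> elem_O_minus l \<epsilon>"
| x_m1_i: "i \<in> {2..int l} \<Longrightarrow>
    1\<^sub>m (2 * l) + t \<cdot>\<^sub>m (- e_minus l (- 1) (- i) + (2 * \<epsilon>) \<cdot>\<^sub>m e_minus l i (- 1))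
      - (\<epsilon> * t\<^sup>2) \<cdot>\<^sub>m e_minus l i (- i) \<in> elem_O_minus l \<epsilon>"
| x_1: "t\<^sup>2 + \<epsilon> * s\<^sup>2 = 1 \<Longrightarrow>
    1\<^sub>m (2 * l) + (t - 1) \<cdot>\<^sub>m e_minus l 1 1 - (t + 1) \<cdot>\<^sub>m e_minus l (- 1) (- 1)
      + s \<cdot>\<^sub>m (e_minus l (- 1) 1 + \<epsilon> \<cdot>\<^sub>m e_minus l 1 (- 1)) \<in> elem_O_minus l \<epsilon>"
| x_2: "1\<^sub>m (2 * l) - 2 \<cdot>\<^sub>m e_minus l (- 1) (- 1) \<in> elem_O_minus l \<epsilon>"

definition x_A0 :: "nat \<Rightarrow> 'a::field \<Rightarrow> 'a \<Rightarrow> 'a \<Rightarrow> 'a \<Rightarrow> 'a mat" where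
  "x_A0 l t s p r =
     1\<^sub>m (2 * l) + (t - 1) \<cdot>\<^sub>m e_minus l 1 1 + (s - 1) \<cdot>\<^sub>m e_minus l (- 1) (- 1)
       + p \<cdot>\<^sub>m e_minus l 1 (- 1) + r \<cdot>\<^sub>m e_minus l (- 1) 1"

inductive_set elem_O_minus2 :: "nat \<Rightarrow> 'a::field \<Rightarrow> 'a mat set" for l \<alpha> where
  common: "g \<in> elem_common (2 * l) (e_minus l) {2..int l} \<Longrightarrow> g \<in> elem_O_minus2 l \<alpha>"
| w: "i \<in> {2..int l} \<Longrightarrow> w_mat (2 * l) (e_minus l) i \<in> elem_O_minus2 l \<alpha>"
| x_1_mi: "i \<in> {2..int l} \<Longrightarrow>
    1\<^sub>m (2 * l) + t \<cdot>\<^sub>m e_minus l 1 (- i) + t \<cdot>\<^sub>m e_minus l i (- 1)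
      + (\<alpha> * t\<^sup>2) \<cdot>\<^sub>m e_minus l i (- i) \<in> elem_O_minus2 l \<alpha>"
| x_m1_mi: "i \<in> {2..int l} \<Longrightarrow>
    1\<^sub>m (2 * l) + t \<cdot>\<^sub>m e_minus l (- 1) (- i) + t \<cdot>\<^sub>m e_minus l i 1
      + (\<alpha> * t\<^sup>2) \<cdot>\<^sub>m e_minus l i (- i) \<in> elem_O_minus2 l \<alpha>"
| x_A0: "\<lbrakk>t * s + p * r = 1; x_A0 l t s p r \<in> O_minus2 l \<alpha>\<rbrakk> \<Longrightarrow>
    x_A0 l t s p r \<in> elem_O_minus2 l \<alpha>"

inductive_set elem_Sp :: "nat \<Rightarrow> 'a::field mat set" for l where
  pos_pos: "\<lbrakk>i \<in> {1..int l}; j \<in> {1..int l}; i \<noteq> j\<rbrakk> \<Longrightarrow>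
    1\<^sub>m (2 * l) + t \<cdot>\<^sub>m (e_even l i j - e_even l (- j) (- i)) \<in> elem_Sp l"
| pos_neg: "\<lbrakk>i \<in> {1..int l}; j \<in> {1..int l}; i < j\<rbrakk> \<Longrightarrow>
    1\<^sub>m (2 * l) + t \<cdot>\<^sub>m (e_even l i (- j) + e_even l j (- i)) \<in> elem_Sp l"
| neg_pos: "\<lbrakk>i \<in> {1..int l}; j \<in> {1..int l}; i < j\<rbrakk> \<Longrightarrow>
    1\<^sub>m (2 * l) + t \<cdot>\<^sub>m (e_even l (- i) j + e_even l (- j) i) \<in> elem_Sp l"
| pos_neg_same: "i \<in> {1..int l} \<Longrightarrow> 1\<^sub>m (2 * l) + t \<cdot>\<^sub>m e_even l i (- i) \<in> elem_Sp l"
| neg_pos_same: "i \<in> {1..int l} \<Longrightarrow> 1\<^sub>m (2 * l) + t \<cdot>\<^sub>m e_even l (- i) i \<in> elem_Sp l"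


section \<open>Products and diagonal matrices\<close>

text \<open>Matrices of varying size do not form a monoid type, so \<open>prod_list\<close> is not available.\<close>

definition mat_prod :: "nat \<Rightarrow> 'a::field mat list \<Rightarrow> 'a mat" where
  "mat_prod d gs = foldr (*) gs (1\<^sub>m d)"

definition diag_plus :: "nat \<Rightarrow> 'a::field \<Rightarrow> 'a mat" where
  "diag_plus l c = mat_diag (2 * l)
     (\<lambda>r. if r = pos_even l (int l) then c else if r = pos_even l (- int l) then inverse c else 1)"

definition diag_odd :: "nat \<Rightarrow> 'a::field \<Rightarrow> 'a \<Rightarrow> 'a mat" where
  "diag_odd l \<theta> c = mat_diag (2 * l + 1)
     (\<lambda>r. if r = pos_odd l 0 then \<theta>
          else if r = pos_odd l (int l) then c else if r = pos_odd l (- int l) then inverse c else 1)"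

definition diag_minus :: "nat \<Rightarrow> 'a::field \<Rightarrow> 'a mat" where
  "diag_minus l c = mat_diag (2 * l)
     (\<lambda>r. if r = pos_minus l (int l) then c else if r = pos_minus l (- int l) then inverse c else 1)"

end

theory Submission
  imports Defs
begin

text \<open>
  All four orthogonal groups and the symplectic group are treated by one elimination argument.
  Let \<open>g\<close> preserve the form and let \<open>e\<^sub>m, f\<^sub>m\<close> be a hyperbolic pair of basis vectors, with labels
  \<open>m\<close> and \<open>-m\<close>. An elementary matrix \<open>v\<^sub>c \<mapsto> v\<^sub>c + t v\<^sub>m\<close> changes besides the coordinate \<open>c\<close> only the
  coordinate \<open>-m\<close>, and it fixes the basis vectors of all pairs not involved.
  First make the coordinate \<open>m\<close> of \<open>g e\<^sub>m\<close> nonzero, then (if another pair is available) equal to 1,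
  then use it as a pivot to clear all coordinates except \<open>-m\<close>; the latter vanishes because the vector
  is isotropic. Thus \<open>g e\<^sub>m\<close> becomes a multiple of \<open>e\<^sub>m\<close>, and the same argument for \<open>g f\<^sub>m\<close>
  does not disturb this. Invariance of the bilinear form then makes \<open>g\<close> act on the orthogonal complement of
  the pair. The last pair leaves the scalar \<open>\<lambda>\<close>, and what remains is an isometry of the space without
  hyperbolic labels, of dimension at most 2.
\<close>

section \<open>Matrices acting on families of columns\<close>

text \<open>Columns are functions on signed labels, so that left multiplication by a matrix becomes
  one map applied to every column. The map \<open>h\<close> of a step multiplies \<open>g\<close> on
  the left, whereas \<open>g\<close> itself has to be written as a product; hence
  \<open>isom\<close> asks that a left inverse of \<open>h\<close>, and not \<open>h\<close>, be
  generated. \<open>Q\<close> and \<open>B\<close> are tracked side by side. In characteristic 2 the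
  polar form satisfies \<open>Bf v v = 0\<close>, so it cannot express that a column is isotropic,
  and in odd dimension it then vanishes on the label 0. In the symplectic case \<open>Q\<close>
  carries no information, and long root elements do the work of isotropy. The scalar \<lambda>
  survives because the pivot at \<open>m\<close> is normalised through another position
  \<open>j\<close> in \<open>P\<close>. In the orthogonal groups this takes \<open>j\<close>
  different from \<open>- m\<close>, and the last pair offers no such \<open>j\<close>. In the
  symplectic group \<open>j = - m\<close> is allowed, which is why no diagonal factor remains
  there.\<close>

lemma mat_prod_carrier:
  assumes "set es \<subseteq> carrier_mat d d"
  shows "mat_prod d es \<in> carrier_mat d d"
  using assms by (induction es) (auto simp: mat_prod_def)

lemma mat_prod_append:
  assumes "set es \<subseteq> carrier_mat d d" "set fs \<subseteq> carrier_mat d d"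
  shows "mat_prod d (es @ fs) = mat_prod d es * mat_prod d fs"
  using assms
proof (induction es)
  case Nil
  then show ?case using mat_prod_carrier[OF Nil(2)] by (simp add: mat_prod_def)
next
  case (Cons x es)
  then have "x * (mat_prod d es * mat_prod d fs) = x * mat_prod d es * mat_prod d fs"
    by (intro assoc_mult_mat[symmetric, of _ d d _ d _ d] mat_prod_carrier) auto
  with Cons show ?case by (simp add: mat_prod_def)
qed

definition axis :: "int \<Rightarrow> int \<Rightarrow> 'a::zero_neq_one" where
  "axis b x = (if x = b then 1 else 0)"

locale label_matrices =
  fixes d :: nat and L :: "int set" and pos :: "int \<Rightarrow> nat" and E :: "'a::field mat set"
  assumes bij_pos: "bij_betw pos L {..<d}"
    and E_carrier: "E \<subseteq> carrier_mat d d"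
begin

definition lab :: "nat \<Rightarrow> int" where
  "lab = the_inv_into L pos"

lemma pos_less: "a \<in> L \<Longrightarrow> pos a < d"
  using bij_pos by (auto simp: bij_betw_def)

lemma lab_pos [simp]: "a \<in> L \<Longrightarrow> lab (pos a) = a"
  unfolding lab_def using bij_pos by (simp add: bij_betw_def the_inv_into_f_f)

lemma pos_lab [simp]: "r < d \<Longrightarrow> pos (lab r) = r"
  unfolding lab_def using bij_pos by (simp add: bij_betw_def f_the_inv_into_f)

lemma lab_in [simp]: "r < d \<Longrightarrow> lab r \<in> L"
  unfolding lab_def using bij_pos the_inv_into_into[of pos L r L] by (simp add: bij_betw_def)

lemma pos_eq_iff: "a \<in> L \<Longrightarrow> b \<in> L \<Longrightarrow> pos a = pos b \<longleftrightarrow> a = b"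
  using lab_pos by metis

lemma lab_eq_iff: "r < d \<Longrightarrow> a \<in> L \<Longrightarrow> lab r = a \<longleftrightarrow> r = pos a"
  by auto

text \<open>The column comes first: \<open>G b\<close> is the column with label \<open>b\<close>.\<close>

definition cmat :: "(int \<Rightarrow> int \<Rightarrow> 'a) \<Rightarrow> 'a mat" where
  "cmat G = mat d d (\<lambda>(r, c). G (lab c) (lab r))"

lemma cmat_carrier [simp]: "cmat G \<in> carrier_mat d d"
  by (simp add: cmat_def)

lemma cmat_cong:
  "(\<And>a b. a \<in> L \<Longrightarrow> b \<in> L \<Longrightarrow> G b a = G' b a) \<Longrightarrow> cmat G = cmat G'"
  unfolding cmat_def by (rule cong_mat) auto

lemma cmat_axis: "cmat axis = 1\<^sub>m d"
proof (rule eq_matI)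
  fix i j assume "i < dim_row (1\<^sub>m d :: 'a mat)" "j < dim_col (1\<^sub>m d :: 'a mat)"
  then show "cmat axis $$ (i, j) = 1\<^sub>m d $$ (i, j)"
    by (auto simp: cmat_def axis_def) (metis pos_lab)
qed (auto simp: cmat_def)

text \<open>The value 0 off \<open>L\<close> turns a column into a vector supported on the labels,
  as \<open>iso_family\<close> demands.\<close>

definition columns :: "'a mat \<Rightarrow> int \<Rightarrow> int \<Rightarrow> 'a" where
  "columns g b a = (if a \<in> L then g $$ (pos a, pos b) else 0)"

lemma cmat_columns:
  assumes "g \<in> carrier_mat d d"
  shows "cmat (columns g) = g"
  using assms by (intro eq_matI) (auto simp: cmat_def columns_def)

text \<open>Quantifying over whole column families makes sums, multiples and products of matrices
  immediate. A matrix determines \<open>h\<close> only on \<open>L\<close>; off \<open>L\<close> the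
  map can be chosen freely, and later it is chosen to be the identity there.\<close>

definition acts :: "'a mat \<Rightarrow> ((int \<Rightarrow> 'a) \<Rightarrow> int \<Rightarrow> 'a) \<Rightarrow> bool" where
  "acts x h \<longleftrightarrow> x \<in> carrier_mat d d \<and> (\<forall>G. x * cmat G = cmat (\<lambda>b. h (G b)))"

lemma acts_cong:
  "acts x h \<Longrightarrow> (\<And>v a. a \<in> L \<Longrightarrow> h v a = h' v a) \<Longrightarrow> acts x h'"
  unfolding acts_def using cmat_cong[of "\<lambda>b. h (G b)" "\<lambda>b. h' (G b)" for G] by simp

lemma acts_one: "acts (1\<^sub>m d) (\<lambda>v. v)"
  unfolding acts_def by (intro conjI allI one_carrier_mat left_mult_one_mat[OF cmat_carrier])

lemma acts_add:
  assumes "acts x h" "acts y k"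
  shows "acts (x + y) (\<lambda>v a. h v a + k v a)"
proof -
  have "(x + y) * cmat G = cmat (\<lambda>b a. h (G b) a + k (G b) a)" for G
  proof -
    have "(x + y) * cmat G = x * cmat G + y * cmat G"
      using assms by (intro add_mult_distrib_mat[of _ d d _ _ d]) (auto simp: acts_def)
    also have "\<dots> = cmat (\<lambda>b. h (G b)) + cmat (\<lambda>b. k (G b))"
      using assms by (simp add: acts_def)
    also have "\<dots> = cmat (\<lambda>b a. h (G b) a + k (G b) a)"
      by (rule eq_matI) (auto simp: cmat_def)
    finally show ?thesis .
  qed
  with assms show ?thesis by (auto simp: acts_def)
qed

lemma acts_smult:
  assumes "acts x h"
  shows "acts (t \<cdot>\<^sub>m x) (\<lambda>v a. t * h v a)"
proof -
  have "(t \<cdot>\<^sub>m x) * cmat G = cmat (\<lambda>b a. t * h (G b) a)" for G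
  proof -
    have "(t \<cdot>\<^sub>m x) * cmat G = t \<cdot>\<^sub>m (x * cmat G)"
      using assms by (intro mult_smult_assoc_mat[of _ d d _ d]) (auto simp: acts_def)
    also have "\<dots> = t \<cdot>\<^sub>m cmat (\<lambda>b. h (G b))"
      using assms by (simp add: acts_def)
    also have "\<dots> = cmat (\<lambda>b a. t * h (G b) a)"
      by (rule eq_matI) (auto simp: cmat_def)
    finally show ?thesis .
  qed
  with assms show ?thesis by (auto simp: acts_def)
qed

lemma acts_uminus:
  assumes "acts x h"
  shows "acts (- x) (\<lambda>v a. - h v a)"
proof -
  have "- x = (-1) \<cdot>\<^sub>m x" by (rule eq_matI) auto
  then show ?thesis using acts_smult[OF assms, of "-1"] by simp
qed

lemma acts_diff:
  assumes "acts x h" "acts y k"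
  shows "acts (x - y) (\<lambda>v a. h v a - k v a)"
proof -
  have "x - y = x + (- y)"
    using assms by (intro eq_matI) (auto simp: acts_def)
  then show ?thesis using acts_add[OF assms(1) acts_uminus[OF assms(2)]] by simp
qed

lemma acts_mat_unit:
  assumes "a \<in> L" "b \<in> L"
  shows "acts (mat_unit d pos a b) (\<lambda>v x. if x = a then v b else 0)"
proof -
  have "mat_unit d pos a b * cmat G = cmat (\<lambda>c x. if x = a then G c b else 0)" for G
  proof (rule eq_matI)
    fix i j assume "i < dim_row (cmat (\<lambda>c x. if x = a then G c b else 0))"
      and "j < dim_col (cmat (\<lambda>c x. if x = a then G c b else 0))"
    then have ij: "i < d" "j < d" by (auto simp: cmat_def)
    have "(mat_unit d pos a b * cmat G) $$ (i, j)
        = (\<Sum>k\<in>{0..<d}. (if i = pos a \<and> k = pos b then 1 else 0) * G (lab j) (lab k))"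
      using ij by (simp add: mat_unit_def cmat_def scalar_prod_def)
    also have "\<dots> = (\<Sum>k\<in>{0..<d}. if k = pos b then (if i = pos a then G (lab j) (lab k) else 0) else 0)"
      by (rule sum.cong) auto
    also have "\<dots> = (if i = pos a then G (lab j) b else 0)"
      using assms pos_less[of b] by (simp add: sum.delta)
    finally show "(mat_unit d pos a b * cmat G) $$ (i, j)
        = cmat (\<lambda>c x. if x = a then G c b else 0) $$ (i, j)"
      using ij assms by (auto simp: cmat_def)
  qed (auto simp: cmat_def mat_unit_def)
  then show ?thesis by (simp add: acts_def mat_unit_def)
qed

lemmas acts_intros =
  acts_diff acts_add acts_uminus acts_smult acts_one acts_mat_unit

lemma acts_mult:
  assumes "acts x h" "acts y k"
  shows "acts (x * y) (\<lambda>v. h (k v))"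
proof -
  have "x * y * cmat G = cmat (\<lambda>b. h (k (G b)))" for G
  proof -
    have "x * y * cmat G = x * (y * cmat G)"
      using assms by (intro assoc_mult_mat[of _ d d _ d _ d]) (auto simp: acts_def)
    then show ?thesis using assms by (simp add: acts_def)
  qed
  with assms show ?thesis by (auto simp: acts_def)
qed

lemma acts_inverse_eq:
  assumes "acts x h" "acts y k" "\<And>v. h (k v) = v"
  shows "x * y = 1\<^sub>m d"
proof -
  have "x * y * cmat axis = cmat axis"
    using acts_mult[OF assms(1,2)] assms(3) by (simp add: acts_def)
  moreover have "x * y \<in> carrier_mat d d" using assms(1,2) by (auto simp: acts_def)
  ultimately show ?thesis using right_mult_one_mat[of "x * y" d d] by (simp add: cmat_axis)
qed

section \<open>Maps realised by products of elementary matrices\<close>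

definition gen :: "((int \<Rightarrow> 'a) \<Rightarrow> int \<Rightarrow> 'a) \<Rightarrow> bool" where
  "gen h \<longleftrightarrow> (\<exists>es. set es \<subseteq> E \<and> acts (mat_prod d es) h)"

lemma gen_id: "gen (\<lambda>v. v)"
proof -
  have "acts (mat_prod d []) (\<lambda>v. v)" by (simp add: mat_prod_def acts_one)
  then show ?thesis unfolding gen_def by (intro exI[of _ "[]"]) simp
qed

lemma gen_elem:
  assumes "x \<in> E" "acts x h"
  shows "gen h"
proof -
  have "x \<in> carrier_mat d d" using assms E_carrier by auto
  then have "mat_prod d [x] = x" by (simp add: mat_prod_def)
  with assms show ?thesis unfolding gen_def by (intro exI[of _ "[x]"]) simp
qed

lemma gen_comp:
  assumes "gen h" "gen k"
  shows "gen (\<lambda>v. h (k v))"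
proof -
  obtain es fs where *: "set es \<subseteq> E" "acts (mat_prod d es) h" "set fs \<subseteq> E" "acts (mat_prod d fs) k"
    using assms by (auto simp: gen_def)
  then have "mat_prod d (es @ fs) = mat_prod d es * mat_prod d fs"
    using E_carrier by (intro mat_prod_append) auto
  with acts_mult[OF *(2,4)] * show ?thesis
    unfolding gen_def by (intro exI[of _ "es @ fs"]) simp
qed

lemma gen_elemI:
  assumes "x \<in> E" "acts x h" "\<And>v a. a \<in> L \<Longrightarrow> h v a = h' v a"
  shows "gen h'"
  using gen_elem acts_cong assms by blast

lemma cmat_diag: "cmat (\<lambda>b x. f b * axis b x) = mat_diag d (\<lambda>r. f (lab r))"
proof (rule eq_matI)
  fix i j assume "i < dim_row (mat_diag d (\<lambda>r. f (lab r)))" "j < dim_col (mat_diag d (\<lambda>r. f (lab r)))"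
  then show "cmat (\<lambda>b x. f b * axis b x) $$ (i, j) = mat_diag d (\<lambda>r. f (lab r)) $$ (i, j)"
    by (auto simp: cmat_def axis_def mat_diag_def) (metis pos_lab)
qed (auto simp: cmat_def mat_diag_def)

lemma gen_w_mat:
  assumes "w_mat d (mat_unit d pos) i \<in> E" "i \<in> L" "- i \<in> L" "i \<noteq> - i"
  shows "gen (\<lambda>v x. if x = i then v (- i) else if x = - i then v i else v x)"
  by (rule gen_elemI[OF assms(1)], unfold w_mat_def,
      (rule acts_intros | (use assms in auto)[1])+)

text \<open>Serves the minus type groups: the isometry left on the labels \<open>1\<close> and
  \<open>- 1\<close> is moved from the column family into the product, leaving a diagonal
  family.\<close>

lemma gen_mult:
  assumes "gen h" "set es \<subseteq> E" "g = mat_prod d es * cmat (\<lambda>b. h (G b))"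
  shows "\<exists>fs. set fs \<subseteq> E \<and> g = mat_prod d fs * cmat G"
proof -
  obtain fs where fs: "set fs \<subseteq> E" "acts (mat_prod d fs) h" using assms(1) by (auto simp: gen_def)
  have c: "set es \<subseteq> carrier_mat d d" "set fs \<subseteq> carrier_mat d d" using assms(2) fs(1) E_carrier by auto
  have "g = mat_prod d es * (mat_prod d fs * cmat G)" using assms(3) fs(2) by (simp add: acts_def)
  also have "\<dots> = mat_prod d (es @ fs) * cmat G"
    using assoc_mult_mat[OF mat_prod_carrier[OF c(1)] mat_prod_carrier[OF c(2)] cmat_carrier]
    by (simp only: mat_prod_append[OF c])
  finally show ?thesis using assms(2) fs(1) by (intro exI[of _ "es @ fs"]) simp
qed

end

section \<open>Witt reduction\<close>

text \<open>Kept apart from \<open>witt_reduction\<close> because the assumptions there mention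
  \<open>isom\<close>, \<open>shear\<close> and \<open>fixes_off\<close>, which must be defined from
  the bare data first.\<close>

locale reduction = label_matrices d L pos E
  for d L pos and E :: "'a::field mat set" +
  fixes J :: "int set" and B :: "(int \<Rightarrow> 'a) \<Rightarrow> (int \<Rightarrow> 'a) \<Rightarrow> 'a" and Q :: "(int \<Rightarrow> 'a) \<Rightarrow> 'a"
    and \<sigma> :: "int \<Rightarrow> 'a" and ext :: bool
  assumes finite_J: "finite J"
    and J_pos: "\<And>i. i \<in> J \<Longrightarrow> i > 0"
    and J_L: "J \<union> uminus ` J \<subseteq> L"
begin

abbreviation P where "P \<equiv> J \<union> uminus ` J"
abbreviation K where "K \<equiv> L - P"

text \<open>The generated left inverse is what enters the product: it leads from the straightened
  family back to the original one.\<close>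

definition isom :: "((int \<Rightarrow> 'a) \<Rightarrow> int \<Rightarrow> 'a) \<Rightarrow> bool" where
  "isom h \<longleftrightarrow> (\<forall>v. Q (h v) = Q v) \<and> (\<forall>v w. B (h v) (h w) = B v w)
    \<and> (\<forall>v x. x \<notin> L \<longrightarrow> h v x = v x) \<and> (\<exists>h'. gen h' \<and> (\<forall>v. h' (h v) = v))"

text \<open>Protects columns that are already straightened: \<open>axis b\<close> vanishes on
  \<open>S\<close> whenever \<open>b\<close> lies outside \<open>S\<close>.\<close>

definition fixes_off :: "int set \<Rightarrow> ((int \<Rightarrow> 'a) \<Rightarrow> int \<Rightarrow> 'a) \<Rightarrow> bool" where
  "fixes_off S h \<longleftrightarrow> (\<forall>v. (\<forall>x\<in>S. v x = 0) \<longrightarrow> h v = v)"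

text \<open>All that elimination uses of a matrix in the group. Only values on pairs of columns
  occur, so these conditions pass to \<open>h (G b)\<close> without any linearity of
  \<open>h\<close>.\<close>

definition iso_family :: "(int \<Rightarrow> int \<Rightarrow> 'a) \<Rightarrow> bool" where
  "iso_family G \<longleftrightarrow> (\<forall>b\<in>L. Q (G b) = Q (axis b)) \<and> (\<forall>b\<in>L. \<forall>c\<in>L. B (G b) (G c) = B (axis b) (axis c))
    \<and> (\<forall>b\<in>L. \<forall>x. x \<notin> L \<longrightarrow> G b x = 0)"

lemma isom_id: "isom (\<lambda>v. v)"
  unfolding isom_def by (intro conjI allI impI exI[of _ "\<lambda>v. v"] gen_id refl)

lemma isom_comp:
  assumes "isom h" "isom k"
  shows "isom (\<lambda>v. h (k v))"
proof -
  obtain h' k' where *: "gen h'" "\<forall>v. h' (h v) = v" "gen k'" "\<forall>v. k' (k v) = v"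
    using assms unfolding isom_def by blast
  have "gen (\<lambda>v. k' (h' v))" using gen_comp * by blast
  moreover have "k' (h' (h (k v))) = v" for v using * by simp
  ultimately have "\<exists>h'. gen h' \<and> (\<forall>v. h' (h (k v)) = v)" by (intro exI[of _ "\<lambda>v. k' (h' v)"]) simp
  then show ?thesis using assms unfolding isom_def by simp
qed

lemma fixes_off_id: "fixes_off S (\<lambda>v. v)"
  by (simp add: fixes_off_def)

lemma fixes_off_comp: "fixes_off S h \<Longrightarrow> fixes_off S k \<Longrightarrow> fixes_off S (\<lambda>v. h (k v))"
  by (auto simp: fixes_off_def)

lemma fixes_off_mono: "fixes_off S h \<Longrightarrow> S \<subseteq> S' \<Longrightarrow> fixes_off S' h"
  by (auto simp: fixes_off_def)

lemma iso_family_map: "isom h \<Longrightarrow> iso_family G \<Longrightarrow> iso_family (\<lambda>b. h (G b))"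
  unfolding isom_def iso_family_def by simp

text \<open>The value at \<open>- m\<close> is left open, so that root elements, long root elements
  and Eichler transformations for labels in \<open>K\<close> all qualify. The last conjunct lists
  the coordinates on which the side effect may depend: \<open>m\<close>, \<open>- c\<close> if
  \<open>c\<close> has a partner, and those in \<open>K\<close>.\<close>

definition shear :: "int \<Rightarrow> int \<Rightarrow> 'a \<Rightarrow> ((int \<Rightarrow> 'a) \<Rightarrow> int \<Rightarrow> 'a) \<Rightarrow> bool" where
  "shear c m t h \<longleftrightarrow> isom h \<and> (\<forall>v x. x \<noteq> c \<longrightarrow> x \<noteq> - m \<longrightarrow> h v x = v x) \<and> (\<forall>v. h v c = v c + t * v m)
    \<and> (\<forall>v. v m = 0 \<longrightarrow> (c \<in> P \<longrightarrow> v (- c) = 0) \<longrightarrow> (\<forall>x\<in>K. v x = 0) \<longrightarrow> h v = v)"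

end

text \<open>\<open>\<sigma> c\<close> is the value of \<open>B\<close> at the pair with labels \<open>c\<close> and \<open>- c\<close>. The flag \<open>ext\<close> holds in the symplectic
  case, where long root elements (\<open>c = - m\<close>) are available and \<open>Q\<close> is taken to be zero.\<close>

locale witt_reduction = reduction d L pos E J B Q \<sigma> ext
  for d L pos and E :: "'a::field mat set" and J B Q \<sigma> ext +
  assumes B_axis: "\<And>c v. c \<in> P \<Longrightarrow> B (axis c) v = \<sigma> c * v (- c)"
    and \<sigma>_nonzero: "\<And>c. c \<in> P \<Longrightarrow> \<sigma> c \<noteq> 0"
    and B_scale: "\<And>a v w. B (\<lambda>x. a * v x) w = a * B v w"
    and Q_axis: "\<And>m. m \<in> P \<Longrightarrow> Q (axis m) = 0"
    and Q_plane: "\<And>m v. \<lbrakk>\<not> ext; m \<in> P; \<And>x. x \<noteq> m \<Longrightarrow> x \<noteq> - m \<Longrightarrow> v x = 0\<rbrakk> \<Longrightarrow> Q v = v m * v (- m)"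
    and ex_shear: "\<And>c m t. \<lbrakk>c \<in> L; m \<in> P; c \<noteq> m; c \<noteq> - m \<or> ext\<rbrakk> \<Longrightarrow> \<exists>h. shear c m t h"
    and start: "\<And>m v w. \<lbrakk>m \<in> J; v m = 0; \<And>x. x \<noteq> - m \<Longrightarrow> x \<notin> K \<Longrightarrow> v x = 0; Q v = 0; B v w \<noteq> 0\<rbrakk>
      \<Longrightarrow> \<exists>h. isom h \<and> fixes_off (insert m (insert (- m) K)) h \<and> h v m \<noteq> 0"
begin

text \<open>The sets off which shears between their members act trivially: the side effect of a
  shear may read the coordinate \<open>- c\<close> and all coordinates in \<open>K\<close>.\<close>

definition admissible :: "int set \<Rightarrow> bool" where
  "admissible S \<longleftrightarrow> S \<subseteq> L \<and> K \<subseteq> S \<and> (\<forall>x\<in>P \<inter> S. - x \<in> S)"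

lemma shear_fixes_off:
  assumes h: "shear c m t h" and "m \<in> S" "c \<in> S" "admissible S"
  shows "fixes_off S h"
  unfolding fixes_off_def
proof (intro allI impI)
  fix v :: "int \<Rightarrow> 'a" assume v: "\<forall>x\<in>S. v x = 0"
  have "v m = 0" using assms(2) v by simp
  moreover have "c \<in> P \<longrightarrow> v (- c) = 0" using assms(3,4) v by (auto simp: admissible_def)
  moreover have "\<forall>x\<in>K. v x = 0" using assms(4) v by (auto simp: admissible_def)
  ultimately show "h v = v" using h unfolding shear_def by (elim conjE) simp
qed

lemma finite_L: "finite L"
  using bij_pos bij_betw_finite by fastforce

lemma P_neq_uminus: "c \<in> P \<Longrightarrow> c \<noteq> - c"
  using J_pos by force

lemma K_neq_uminus: "- m \<in> P \<Longrightarrow> x \<in> K \<Longrightarrow> x \<noteq> - m"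
  by blast

text \<open>Gaussian elimination with pivot position \<open>m\<close>; position \<open>- m\<close> absorbs the side effects.\<close>

lemma clear_coordinates:
  assumes "finite C" "C \<subseteq> S - {m, - m}" "m \<in> S" "m \<in> P" "admissible S" "v m \<noteq> 0"
  shows "\<exists>h. isom h \<and> fixes_off S h \<and> h v m = v m \<and> (\<forall>x\<in>C. h v x = 0)
    \<and> (\<forall>x. x \<notin> C \<longrightarrow> x \<noteq> - m \<longrightarrow> h v x = v x)
    \<and> (\<forall>u. (\<forall>x. x \<noteq> - m \<longrightarrow> u x = 0) \<longrightarrow> h u = u)"
  using assms(1,2)
proof (induction C)
  case empty
  show ?case by (rule exI[of _ "\<lambda>v. v"]) (simp add: isom_id fixes_off_id)
next
  case (insert c C)
  then have "C \<subseteq> S - {m, - m}" by simp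
  from insert.IH[OF this] obtain h where h: "isom h" "fixes_off S h" "h v m = v m" "\<forall>x\<in>C. h v x = 0"
    "\<forall>x. x \<notin> C \<longrightarrow> x \<noteq> - m \<longrightarrow> h v x = v x"
    "\<forall>u. (\<forall>x. x \<noteq> - m \<longrightarrow> u x = 0) \<longrightarrow> h u = u" by (elim exE conjE) (rule that)
  have c: "c \<in> S" "c \<in> L" "c \<noteq> m" "c \<noteq> - m" using insert assms(5) by (auto simp: admissible_def)
  have m0: "m \<noteq> - m" "- m \<in> P" using assms(4) J_pos by force+
  obtain k where k: "shear c m (- v c / v m) k" using ex_shear[OF c(2) assms(4) c(3)] c by blast
  have k1: "k w x = w x" if "x \<noteq> c" "x \<noteq> - m" for w x using k that by (simp add: shear_def)
  have k2: "k w c = w c + (- v c / v m) * w m" for w using k by (simp add: shear_def)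
  have k3: "k u = u" if u: "\<forall>x. x \<noteq> - m \<longrightarrow> u x = 0" for u
  proof -
    have "u m = 0" "u (- c) = 0" using u m0 c by simp_all
    moreover have "\<forall>x\<in>K. u x = 0" by (intro ballI u[rule_format] K_neq_uminus m0)
    ultimately show ?thesis using k unfolding shear_def by (elim conjE) simp
  qed
  have hc: "h v c = v c" using h(5) insert.hyps(2) c by simp
  have r1: "isom (\<lambda>v. k (h v))" using isom_comp[of k h] k h by (simp add: shear_def)
  have r2: "fixes_off S (\<lambda>v. k (h v))"
    using fixes_off_comp[OF shear_fixes_off[OF k assms(3) c(1) assms(5)] h(2)] .
  have r3: "k (h v) m = v m" using k1 h(3) c m0 by simp
  have r4: "\<forall>x\<in>insert c C. k (h v) x = 0"
  proof
    fix x assume "x \<in> insert c C"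
    then consider "x = c" | "x \<in> C" "x \<noteq> c" by blast
    then show "k (h v) x = 0"
    proof cases
      case 1
      then show ?thesis using k2 hc h(3) assms(6) by simp
    next
      case 2
      then have "x \<noteq> - m" using insert by auto
      then show ?thesis using k1 2 h(4) by simp
    qed
  qed
  have r5: "\<forall>x. x \<notin> insert c C \<longrightarrow> x \<noteq> - m \<longrightarrow> k (h v) x = v x" using k1 h(5) by simp
  \<comment> \<open>With \<open>- m\<close> in the role of the pivot, this clause protects the
    column of \<open>m\<close> that was straightened before.\<close>
  have r6: "\<forall>u. (\<forall>x. x \<noteq> - m \<longrightarrow> u x = 0) \<longrightarrow> k (h u) = u"
    using h(6) k3 by metis
  show ?case by (rule exI[of _ "\<lambda>v. k (h v)"]) (intro conjI r1 r2 r3 r4 r5 r6)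
qed

text \<open>\<open>- m\<close> can be cleared by a shear if \<open>ext\<close> holds; otherwise isotropy forces it to be zero.\<close>

lemma clear_all:
  assumes "m \<in> S" "m \<in> P" "admissible S" "v m \<noteq> 0" "Q v = 0" "\<And>x. x \<notin> S \<Longrightarrow> v x = 0"
  shows "\<exists>h. isom h \<and> fixes_off S h \<and> h v = (\<lambda>x. v m * axis m x)
    \<and> (\<forall>u. (\<forall>x. x \<noteq> - m \<longrightarrow> u x = 0) \<longrightarrow> h u = u)"
proof -
  have S: "S \<subseteq> L" "- m \<in> S" using assms by (auto simp: admissible_def)
  have m0: "m \<noteq> - m" "- m \<in> P" using assms(2) P_neq_uminus by auto
  have "finite (S - {m, - m})" using S finite_L finite_subset by blast
  from clear_coordinates[of _ S m v, OF this subset_refl assms(1-4)]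
  obtain h where h: "isom h" "fixes_off S h" "h v m = v m" "\<forall>x\<in>S - {m, - m}. h v x = 0"
    "\<forall>x. x \<notin> S - {m, - m} \<longrightarrow> x \<noteq> - m \<longrightarrow> h v x = v x"
    "\<forall>u. (\<forall>x. x \<noteq> - m \<longrightarrow> u x = 0) \<longrightarrow> h u = u" by (elim exE conjE) (rule that)
  have hv: "h v x = 0" if "x \<noteq> m" "x \<noteq> - m" for x
  proof (cases "x \<in> S")
    case True
    then show ?thesis using h(4) that by simp
  next
    case False
    then have "h v x = v x" using h(5) that(2) by simp
    with assms(6)[OF False] show ?thesis by simp
  qed
  show ?thesis
  proof (cases ext)
    case True
    obtain k where k: "shear (- m) m (- h v (- m) / v m) k"
      using ex_shear[of "- m" m "- h v (- m) / v m"] m0 assms(2) True S by auto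
    have r0: "k (h v) x = v m * axis m x" for x
    proof (cases "x = - m")
      case True
      have "k (h v) (- m) = h v (- m) + (- h v (- m) / v m) * h v m"
        using k by (simp add: shear_def)
      then show ?thesis using True h(3) m0 assms(4) by (simp add: axis_def)
    next
      case False
      then have "k (h v) x = h v x" using k by (simp add: shear_def)
      then show ?thesis using hv[of x] False h(3) by (simp add: axis_def)
    qed
    have r1: "k u = u" if u: "\<forall>x. x \<noteq> - m \<longrightarrow> u x = 0" for u
    proof -
      have "u m = 0" "u (- (- m)) = 0" using u m0 by simp_all
      moreover have "\<forall>x\<in>K. u x = 0" by (intro ballI u[rule_format] K_neq_uminus m0)
      ultimately show ?thesis using k unfolding shear_def by (elim conjE) simp
    qed
    have r2: "isom (\<lambda>v. k (h v))" using isom_comp[of k h] k h by (simp add: shear_def)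
    have r3: "fixes_off S (\<lambda>v. k (h v))"
      using fixes_off_comp[OF shear_fixes_off[OF k assms(1) S(2) assms(3)] h(2)] .
    have r4: "k (h v) = (\<lambda>x. v m * axis m x)" using r0 by (rule ext)
    have r5: "\<forall>u. (\<forall>x. x \<noteq> - m \<longrightarrow> u x = 0) \<longrightarrow> k (h u) = u"
      using h(6) r1 by simp
    show ?thesis by (rule exI[of _ "\<lambda>v. k (h v)"]) (intro conjI r2 r3 r4 r5)
  next
    case False
    have "Q (h v) = 0" using h(1) assms(5) by (simp add: isom_def)
    then have "h v m * h v (- m) = 0" using Q_plane[OF False assms(2) hv] by simp
    then have "h v (- m) = 0" using h(3) assms(4) by simp
    then have "h v x = v m * axis m x" for x
      using hv[of x] h(3) by (cases "x = - m"; cases "x = m") (simp_all add: axis_def)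
    then have "h v = (\<lambda>x. v m * axis m x)" by (rule ext)
    then show ?thesis using h(1,2,6) by (intro exI[of _ h] conjI)
  qed
qed

text \<open>A nonzero coordinate at a label \<open>c\<close> in \<open>P\<close> other than
  \<open>- m\<close> is carried to \<open>m\<close> by a shear with pivot \<open>c\<close>. What
  escapes is a vector supported on \<open>- m\<close> and \<open>K\<close>; there the remedy depends
  on the type of the group and is supplied by \<open>start\<close>. The vector \<open>w\<close>
  witnesses that \<open>v\<close> is not in the radical of \<open>B\<close>.\<close>

lemma make_nonzero:
  assumes "m \<in> S" "m \<in> J" "admissible S" "Q v = 0" "B v w \<noteq> 0" "\<And>x. x \<notin> S \<Longrightarrow> v x = 0"
  shows "\<exists>h. isom h \<and> fixes_off S h \<and> h v m \<noteq> 0"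
proof -
  have S: "S \<subseteq> L" "- m \<in> S" "K \<subseteq> S" using assms by (auto simp: admissible_def)
  consider "v m \<noteq> 0" | c where "v m = 0" "v c \<noteq> 0" "c \<in> P" "c \<noteq> - m"
    | "v m = 0" "\<And>x. x \<noteq> - m \<Longrightarrow> x \<notin> K \<Longrightarrow> v x = 0"
    using assms(6) S(1) by blast
  then show ?thesis
  proof cases
    case 1
    show ?thesis by (rule exI[of _ "\<lambda>v. v"]) (simp add: isom_id fixes_off_id 1)
  next
    case 2
    have "m \<in> L" "m \<noteq> c" "m \<noteq> - c" "c \<in> S" using 2 assms S by auto
    then obtain h where h: "shear m c 1 h" using ex_shear[of m c 1] 2 by auto
    have "h v m = v c" using h 2 by (simp add: shear_def)
    moreover have "isom h" using h by (simp add: shear_def)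
    ultimately show ?thesis using shear_fixes_off[OF h \<open>c \<in> S\<close> assms(1,3)] 2(2) by metis
  next
    case 3
    obtain h where h: "isom h" "fixes_off (insert m (insert (- m) K)) h" "h v m \<noteq> 0"
      using start[OF assms(2) 3 assms(4,5)] by metis
    have "insert m (insert (- m) K) \<subseteq> S" using S assms(1) by auto
    with fixes_off_mono[OF h(2)] have "fixes_off S h" by metis
    with h show ?thesis by metis
  qed
qed

text \<open>Two shears through an auxiliary position \<open>j\<close> normalise the pivot.\<close>

lemma make_one:
  assumes "m \<in> S" "m \<in> P" "admissible S" "v m \<noteq> 0" "j \<in> S" "j \<in> P" "j \<noteq> m" "j \<noteq> - m \<or> ext"
  shows "\<exists>h. isom h \<and> fixes_off S h \<and> h v m = 1"
proof -
  have L: "j \<in> L" "m \<in> L" "m \<noteq> - m" "j \<noteq> - j" using assms J_L P_neq_uminus by auto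
  \<comment> \<open>The first shear makes the coordinate \<open>j\<close> equal to 1 and leaves
    \<open>v m\<close> alone; adding \<open>1 - v m\<close> times that coordinate to position
    \<open>m\<close> then gives 1.\<close>
  obtain h where h: "shear j m ((1 - v j) / v m) h" using ex_shear[of j m "(1 - v j) / v m"] L assms by auto
  obtain k where k: "shear m j (1 - v m) k" using ex_shear[of m j "1 - v m"] L assms
    by auto
  have "h v j = 1" "h v m = v m" using h assms L unfolding shear_def by auto
  then have "k (h v) m = 1" using k by (simp add: shear_def)
  moreover have "isom (\<lambda>v. k (h v))" using isom_comp[of k h] k h by (simp add: shear_def)
  moreover have "fixes_off S (\<lambda>v. k (h v))"
    using fixes_off_comp[OF shear_fixes_off[OF k assms(5,1,3)] shear_fixes_off[OF h assms(1,5,3)]] .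
  ultimately show ?thesis by (intro exI[of _ "\<lambda>v. k (h v)"]) simp
qed

lemma axis_off: "b \<notin> S \<Longrightarrow> \<forall>x\<in>S. axis b x = (0 :: 'a)"
  by (auto simp: axis_def)

text \<open>Up to the factor \<open>\<sigma> c\<close>, this coordinate is the value of
  \<open>B\<close> at the straightened column \<open>axis c\<close> and \<open>G b\<close>, which is
  the value at two orthogonal basis vectors.\<close>

lemma iso_family_vanish:
  assumes "iso_family G" "b \<in> L" "c \<in> P" "G c = axis c" "b \<noteq> - c"
  shows "G b (- c) = 0"
proof -
  have "c \<in> L" using assms(3) J_L by auto
  then have "B (G c) (G b) = B (axis c) (axis b)" using assms(1,2) by (simp add: iso_family_def)
  then have "\<sigma> c * G b (- c) = \<sigma> c * axis b (- c)" using assms(3,4) B_axis by simp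
  then show ?thesis using assms(5) \<sigma>_nonzero[OF assms(3)] by (auto simp: axis_def)
qed

text \<open>All maps used act trivially off \<open>S\<close>, the labels of pairs still to be
  treated together with \<open>K\<close>, so earlier pairs stay intact. The scalars of the two
  columns are inverse to each other because \<open>B\<close> is preserved.\<close>

lemma straighten_pair:
  assumes G: "iso_family G" and J': "J' \<subseteq> J" "m \<in> J'"
    and fixed: "\<And>b. b \<in> P - (J' \<union> uminus ` J') \<Longrightarrow> G b = axis b"
  shows "\<exists>h a. isom h \<and> fixes_off (J' \<union> uminus ` J' \<union> K) h \<and> a \<noteq> 0 \<and> (ext \<or> J' \<noteq> {m} \<longrightarrow> a = 1)
    \<and> h (G m) = (\<lambda>x. a * axis m x) \<and> h (G (- m)) = (\<lambda>x. inverse a * axis (- m) x)"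
proof -
  define S where "S = J' \<union> uminus ` J' \<union> K"
  have mJ: "m \<in> J" using J' by auto
  then have mP: "m \<in> P" "- m \<in> P" by auto
  have mL: "m \<in> L" "- m \<in> L" using mP J_L by auto
  have mS: "m \<in> S" "- m \<in> S" using J' by (auto simp: S_def)
  have mn: "m \<noteq> - m" using P_neq_uminus mP by blast
  have S: "admissible S" using J' J_L by (auto simp: admissible_def S_def)
  define invar where "invar F \<longleftrightarrow> iso_family F \<and> (\<forall>b\<in>P - S. F b = axis b)" for F :: "int \<Rightarrow> int \<Rightarrow> 'a"
  \<comment> \<open>A label outside \<open>S\<close> is the partner of a straightened column, and
    orthogonality to that column kills the coordinate; so only positions in \<open>S\<close> have to
    be cleared.\<close>
  have supp: "F b x = 0" if F: "invar F" and "x \<notin> S" "b = m \<or> b = - m" for F x b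
  proof (cases "x \<in> L")
    case False
    then show ?thesis using F that mL by (auto simp: iso_family_def invar_def)
  next
    case True
    then have "x \<in> P" using that by (auto simp: S_def)
    then have x: "- x \<in> P - S" using that by (force simp: S_def)
    have "b \<noteq> x" "b \<in> L" using that mS mL by auto
    moreover have "F (- x) = axis (- x)" using F x by (simp add: invar_def)
    ultimately show ?thesis using iso_family_vanish[of F b "- x"] x F by (simp add: invar_def)
  qed
  have inv_map: "invar (\<lambda>b. h (F b))" if "invar F" "isom h" "fixes_off S h" for F h
    unfolding invar_def
  proof (intro conjI ballI)
    show "iso_family (\<lambda>b. h (F b))" using iso_family_map that by (simp add: invar_def)
    fix b assume "b \<in> P - S"
    then show "h (F b) = axis b"
      using that axis_off[of b S] by (simp add: invar_def fixes_off_def)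
  qed
  have B_pair: "B (F m) (F (- m)) = \<sigma> m" if "invar F" for F
  proof -
    have "B (F m) (F (- m)) = B (axis m) (axis (- m))"
      using that mL by (simp add: invar_def iso_family_def)
    then show ?thesis using B_axis[OF mP(1)] by (simp add: axis_def)
  qed
  have Q_zero: "Q (F m) = 0" "Q (F (- m)) = 0" if "invar F" for F
    using that mL mP Q_axis by (simp_all add: invar_def iso_family_def)
  have "P - S = P - (J' \<union> uminus ` J')" by (auto simp: S_def)
  then have G0: "invar G" using G fixed unfolding invar_def by simp
  obtain h1 where h1: "isom h1" "fixes_off S h1" "h1 (G m) m \<noteq> 0"
    using make_nonzero[OF mS(1) mJ S Q_zero(1)[OF G0], of "G (- m)"] B_pair[OF G0]
      \<sigma>_nonzero[OF mP(1)] supp[OF G0] by auto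
  define F1 where "F1 b = h1 (G b)" for b
  have F1: "invar F1" using inv_map[OF G0 h1(1,2)] by (simp add: F1_def[abs_def])
  obtain h2 where h2: "isom h2" "fixes_off S h2" "h2 (F1 m) m \<noteq> 0"
    "ext \<or> J' \<noteq> {m} \<Longrightarrow> h2 (F1 m) m = 1"
  proof (cases "ext \<or> J' \<noteq> {m}")
    case True
    \<comment> \<open>With long root elements the partner \<open>- m\<close> itself can serve;
      otherwise another pair has to be left in \<open>J'\<close>.\<close>
    obtain j where j: "j \<in> S" "j \<in> P" "j \<noteq> m" "j \<noteq> - m \<or> ext"
    proof (cases ext)
      case True
      then show ?thesis using that[of "- m"] mS mP mn by auto
    next
      case False
      then obtain j where "j \<in> J'" "j \<noteq> m" using True J' by auto
      moreover from this have "j \<noteq> - m" using J_pos[of j] J_pos[OF mJ] J' by auto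
      ultimately show ?thesis using that[of j] J' by (auto simp: S_def)
    qed
    have "F1 m m \<noteq> 0" using h1 by (simp add: F1_def)
    from make_one[of m S "F1 m", OF mS(1) mP(1) S this j]
    obtain h where "isom h" "fixes_off S h" "h (F1 m) m = 1" by (elim exE conjE) (rule that)
    then show ?thesis using that[of h] by simp
  next
    case False
    then show ?thesis using that[of "\<lambda>v. v"] isom_id fixes_off_id h1 by (simp add: F1_def)
  qed
  define F2 where "F2 b = h2 (F1 b)" for b
  have F2: "invar F2" using inv_map[OF F1 h2(1,2)] by (simp add: F2_def[abs_def])
  define a where "a = F2 m m"
  have a: "a \<noteq> 0" "ext \<or> J' \<noteq> {m} \<longrightarrow> a = 1" using h2(3,4) by (auto simp: a_def F2_def)
  have "F2 m m \<noteq> 0" using a by (simp add: a_def)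
  from clear_all[of m S "F2 m", OF mS(1) mP(1) S this Q_zero(1)[OF F2] supp[OF F2]]
  obtain h3 where h3: "isom h3" "fixes_off S h3" "h3 (F2 m) = (\<lambda>x. F2 m m * axis m x)"
    by auto
  define F3 where "F3 b = h3 (F2 b)" for b
  have F3: "invar F3" using inv_map[OF F2 h3(1,2)] by (simp add: F3_def[abs_def])
  have F3m: "F3 m = (\<lambda>x. a * axis m x)" using h3 by (simp add: F3_def a_def)
  \<comment> \<open>The value of \<open>B\<close> at the two columns is still
    \<open>\<sigma> m\<close>, which determines the coordinate \<open>- m\<close> of the second
    column and makes it a pivot.\<close>
  have "a * (\<sigma> m * F3 (- m) (- m)) = \<sigma> m"
    using B_pair[OF F3] B_axis[OF mP(1)] by (simp add: F3m B_scale)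
  then have a': "F3 (- m) (- m) = inverse a"
    using \<sigma>_nonzero[OF mP(1)] a(1) by (simp add: field_simps)
  then have "F3 (- m) (- m) \<noteq> 0" using a by simp
  from clear_all[of "- m" S "F3 (- m)", OF mS(2) mP(2) S this Q_zero(2)[OF F3] supp[OF F3]]
  obtain h4 where h4: "isom h4" "fixes_off S h4"
    "h4 (F3 (- m)) = (\<lambda>x. F3 (- m) (- m) * axis (- m) x)"
    "\<forall>u. (\<forall>x. x \<noteq> - (- m) \<longrightarrow> u x = 0) \<longrightarrow> h4 u = u"
    by auto
  \<comment> \<open>The first column is supported on \<open>m\<close>, the position that absorbs the
    side effects of the pivot \<open>- m\<close>, and is therefore left alone by
    \<open>h4\<close>.\<close>
  have "\<forall>x. x \<noteq> - (- m) \<longrightarrow> F3 m x = 0" by (simp add: F3m axis_def)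
  then have "h4 (F3 m) = (\<lambda>x. a * axis m x)" using h4(4) F3m by simp
  then have e1: "h4 (h3 (h2 (h1 (G m)))) = (\<lambda>x. a * axis m x)"
    by (simp only: F3_def F2_def F1_def)
  have e2: "h4 (h3 (h2 (h1 (G (- m))))) = (\<lambda>x. inverse a * axis (- m) x)"
    using h4(3) a' by (simp add: F3_def F2_def F1_def)
  have i: "isom (\<lambda>v. h4 (h3 (h2 (h1 v))))"
    using isom_comp[OF h4(1) isom_comp[OF h3(1) isom_comp[OF h2(1) h1(1)]]] .
  have f: "fixes_off S (\<lambda>v. h4 (h3 (h2 (h1 v))))"
    using fixes_off_comp[OF h4(2) fixes_off_comp[OF h3(2) fixes_off_comp[OF h2(2) h1(2)]]] .
  show ?thesis
    unfolding S_def[symmetric]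
    by (rule exI[of _ "\<lambda>v. h4 (h3 (h2 (h1 v)))"], rule exI[of _ a]) (intro conjI i f a e1 e2)
qed

text \<open>The pair \<open>\<plusminus>l\<close> comes last, because the other pairs are normalised with its help.\<close>

lemma straighten_all:
  assumes "finite A" "insert l A \<subseteq> J" "l \<notin> A" "iso_family G"
    and "\<forall>b\<in>P - (insert l A \<union> uminus ` insert l A). G b = axis b"
  shows "\<exists>h a. isom h \<and> a \<noteq> 0 \<and> (ext \<longrightarrow> a = 1) \<and> (\<forall>b\<in>P - {l, - l}. h (G b) = axis b)
    \<and> h (G l) = (\<lambda>x. a * axis l x) \<and> h (G (- l)) = (\<lambda>x. inverse a * axis (- l) x)"
  using assms
proof (induction A arbitrary: G rule: finite_induct)
  case empty
  then have fixed: "\<And>b. b \<in> P - ({l} \<union> uminus ` {l}) \<Longrightarrow> G b = axis b" by simp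
  from straighten_pair[of G "{l}" l, OF empty(3) _ _ fixed] empty
  obtain h a where h: "isom h" "fixes_off ({l} \<union> uminus ` {l} \<union> K) h" "a \<noteq> 0" "ext \<longrightarrow> a = 1"
    "h (G l) = (\<lambda>x. a * axis l x)" "h (G (- l)) = (\<lambda>x. inverse a * axis (- l) x)" by auto
  have "h (G b) = axis b" if "b \<in> P - {l, - l}" for b
  proof -
    have "G b = axis b" using fixed that by simp
    moreover have "\<forall>x\<in>{l} \<union> uminus ` {l} \<union> K. (axis b :: int \<Rightarrow> 'a) x = 0"
      by (rule axis_off) (use that in auto)
    ultimately show ?thesis using h(2) by (simp add: fixes_off_def)
  qed
  then show ?case using h by (intro exI[of _ h] exI[of _ a] conjI ballI)
next
  case (insert m A)
  let ?J = "insert l (insert m A)"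
  let ?S = "?J \<union> uminus ` ?J \<union> K"
  have fixed: "\<And>b. b \<in> P - (?J \<union> uminus ` ?J) \<Longrightarrow> G b = axis b" using insert.prems(4) by blast
  have m: "m \<in> ?J" "?J \<noteq> {m}" "?J \<subseteq> J" using insert by auto
  from straighten_pair[OF insert.prems(3) m(3,1) fixed] m(2)
  obtain h a where h: "isom h" "fixes_off ?S h" "a = 1"
    "h (G m) = (\<lambda>x. a * axis m x)" "h (G (- m)) = (\<lambda>x. inverse a * axis (- m) x)" by blast
  have hG: "h (G b) = axis b" if b: "b \<in> P - (insert l A \<union> uminus ` insert l A)" for b
  proof (cases "b = m \<or> b = - m")
    case True
    then show ?thesis using h by auto
  next
    case False
    then have "b \<in> P - (?J \<union> uminus ` ?J)" using b by auto
    moreover from this have "\<forall>x\<in>?S. (axis b :: int \<Rightarrow> 'a) x = 0"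
      by (intro axis_off) auto
    ultimately show ?thesis using h(2) fixed[of b] unfolding fixes_off_def by metis
  qed
  have A: "insert l A \<subseteq> J" "l \<notin> A" using insert.prems by auto
  have "\<forall>b\<in>P - (insert l A \<union> uminus ` insert l A). h (G b) = axis b" using hG by blast
  from insert.IH[OF A iso_family_map[OF h(1) insert.prems(3)] this] obtain k a where k: "isom k" "a \<noteq> 0" "ext \<longrightarrow> a = 1"
    "\<forall>b\<in>P - {l, - l}. k (h (G b)) = axis b" "k (h (G l)) = (\<lambda>x. a * axis l x)"
    "k (h (G (- l))) = (\<lambda>x. inverse a * axis (- l) x)" by (elim exE conjE) (rule that)
  then show ?case using isom_comp[OF k(1) h(1)]
    by (intro exI[of _ "\<lambda>v. k (h v)"] exI[of _ a] conjI)
qed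

text \<open>Columns with labels in \<open>K\<close> need no elimination: they are orthogonal to all
  straightened columns, and these are nonzero multiples of the basis vectors with labels in
  \<open>P\<close>, so every coordinate outside \<open>K\<close> vanishes.\<close>

lemma reduce:
  assumes "l \<in> J" and G: "iso_family G"
  shows "\<exists>es F a. set es \<subseteq> E \<and> cmat G = mat_prod d es * cmat F \<and> iso_family F \<and> a \<noteq> 0
    \<and> (ext \<longrightarrow> a = 1) \<and> (\<forall>b\<in>P - {l, - l}. F b = axis b) \<and> F l = (\<lambda>x. a * axis l x)
    \<and> F (- l) = (\<lambda>x. inverse a * axis (- l) x) \<and> (\<forall>b\<in>K. \<forall>x. x \<notin> K \<longrightarrow> F b x = 0)"
proof -
  have J: "insert l (J - {l}) = J" using assms by auto
  obtain h a where h: "isom h" "a \<noteq> 0" "ext \<longrightarrow> a = 1"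
    "\<forall>b\<in>P - {l, - l}. h (G b) = axis b" "h (G l) = (\<lambda>x. a * axis l x)"
    "h (G (- l)) = (\<lambda>x. inverse a * axis (- l) x)"
    using straighten_all[of "J - {l}" l G] G finite_J unfolding J by auto
  define F where "F b = h (G b)" for b
  have F: "iso_family F" using iso_family_map[OF h(1) G] by (simp add: F_def[abs_def])
  \<comment> \<open>Here the left inverse is turned into the list of elementary matrices.\<close>
  obtain h' where h': "gen h'" "\<And>v. h' (h v) = v" using h(1) by (auto simp: isom_def)
  then obtain es where es: "set es \<subseteq> E" "acts (mat_prod d es) h'" by (auto simp: gen_def)
  then have "mat_prod d es * cmat F = cmat G" using h'(2) by (simp add: acts_def F_def)
  moreover have "F b x = 0" if b: "b \<in> K" and x: "x \<notin> K" for b x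
  proof (cases "x \<in> L")
    case False
    then show ?thesis using F b by (simp add: iso_family_def)
  next
    case True
    then have xP: "- x \<in> P" using x by auto
    then have L: "- x \<in> L" using J_L by auto
    have "B (F (- x)) (F b) = B (axis (- x)) (axis b)"
      using F b L by (simp add: iso_family_def)
    also have "\<dots> = 0" using B_axis[OF xP, of "axis b"] True x b by (auto simp: axis_def)
    finally have *: "B (F (- x)) (F b) = 0" .
    obtain c where c: "c \<noteq> 0" "F (- x) = (\<lambda>y. c * axis (- x) y)"
    proof -
      consider "- x = l" | "- x = - l" | "- x \<in> P - {l, - l}" using xP by blast
      then show ?thesis
      proof cases
        case 1
        show ?thesis using that[of a] h(2,5) unfolding 1 by (simp add: F_def)
      next
        case 2
        show ?thesis using that[of "inverse a"] h(2,6) unfolding 2 by (simp add: F_def)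
      next
        case 3
        then show ?thesis using that[of 1] h(4) by (simp add: F_def)
      qed
    qed
    have "c * (\<sigma> (- x) * F b x) = 0"
      using * B_axis[OF xP, of "F b"] by (simp add: c(2) B_scale)
    then show ?thesis using c(1) \<sigma>_nonzero[OF xP] by simp
  qed
  ultimately show ?thesis using es(1) F h(2-6)
    by (intro exI[of _ es] exI[of _ F] exI[of _ a]) (simp add: F_def)
qed

end

section \<open>Orthogonal groups\<close>

text \<open>\<open>QW\<close> is the quadratic form on the coordinates without hyperbolic partner, and \<open>BW\<close> its polar form.\<close>

locale quadratic_space = label_matrices d L pos E
  for d L pos and E :: "'a::field mat set" +
  fixes J :: "int set" and QW :: "(int \<Rightarrow> 'a) \<Rightarrow> 'a" and BW :: "(int \<Rightarrow> 'a) \<Rightarrow> (int \<Rightarrow> 'a) \<Rightarrow> 'a"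
  assumes finite_J: "finite J"
    and J_pos: "\<And>i. i \<in> J \<Longrightarrow> i > 0"
    and J_L: "J \<union> uminus ` J \<subseteq> L"
    and QW_add: "\<And>v w. QW (\<lambda>x. v x + w x) = QW v + QW w + BW v w"
    and QW_scale: "\<And>a v. QW (\<lambda>x. a * v x) = a\<^sup>2 * QW v"
    and BW_add: "\<And>u v w. BW (\<lambda>x. u x + v x) w = BW u w + BW v w"
    and BW_scale: "\<And>a v w. BW (\<lambda>x. a * v x) w = a * BW v w"
    and QW_local: "\<And>v w. (\<And>x. x \<in> L - (J \<union> uminus ` J) \<Longrightarrow> v x = w x) \<Longrightarrow> QW v = QW w"
    and BW_expand: "\<And>v w. BW v w \<noteq> 0 \<Longrightarrow> \<exists>c\<in>L - (J \<union> uminus ` J). BW (axis c) v \<noteq> 0"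
begin

section \<open>Hyperbolic planes plus a residual form\<close>

definition Qf :: "(int \<Rightarrow> 'a) \<Rightarrow> 'a" where
  "Qf v = (\<Sum>i\<in>J. v i * v (- i)) + QW v"

definition Bf :: "(int \<Rightarrow> 'a) \<Rightarrow> (int \<Rightarrow> 'a) \<Rightarrow> 'a" where
  "Bf v w = (\<Sum>i\<in>J. v i * w (- i) + v (- i) * w i) + BW v w"

sublocale reduction d L pos E J Bf Qf "\<lambda>_. 1" False
  by unfold_locales (use finite_J J_pos J_L in auto)

lemma QW_zero:
  assumes "\<And>x. x \<in> K \<Longrightarrow> v x = 0"
  shows "QW v = 0"
proof -
  have "QW v = QW (\<lambda>x. 0 * v x)" by (rule QW_local) (use assms in auto)
  then show ?thesis using QW_scale[of 0 v] by simp
qed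

text \<open>Through this formula symmetry and locality of the polar form are inherited from
  \<open>QW\<close>.\<close>

lemma BW_eq: "BW v w = QW (\<lambda>x. v x + w x) - QW v - QW w"
  using QW_add[of v w] by simp

lemma BW_commute: "BW v w = BW w v"
  by (simp add: BW_eq add.commute)

lemma BW_zero:
  assumes "\<And>x. x \<in> K \<Longrightarrow> v x = 0"
  shows "BW v w = 0"
proof -
  have "QW (\<lambda>x. v x + w x) = QW w" by (rule QW_local) (use assms in auto)
  then show ?thesis using QW_zero[OF assms] by (simp add: BW_eq)
qed

lemma Qf_add: "Qf (\<lambda>x. v x + w x) = Qf v + Qf w + Bf v w"
  by (simp add: Qf_def Bf_def QW_add algebra_simps sum.distrib)

lemma Qf_scale: "Qf (\<lambda>x. a * v x) = a\<^sup>2 * Qf v"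
  by (simp add: Qf_def QW_scale algebra_simps power2_eq_square sum_distrib_left)

lemma Bf_add: "Bf (\<lambda>x. u x + v x) w = Bf u w + Bf v w"
  by (simp add: Bf_def BW_add algebra_simps sum.distrib)

lemma Bf_scale: "Bf (\<lambda>x. a * v x) w = a * Bf v w"
  by (simp add: Bf_def BW_scale algebra_simps sum_distrib_left sum.distrib)

lemma Bf_commute: "Bf v w = Bf w v"
  by (simp add: Bf_def BW_commute[of v w] algebra_simps sum.distrib)

lemma Bf_axis:
  assumes "c \<in> P"
  shows "Bf (axis c) v = v (- c)"
proof -
  have "BW (axis c) v = 0" by (rule BW_zero) (use assms in \<open>auto simp: axis_def\<close>)
  moreover have "(\<Sum>i\<in>J. axis c i * v (- i) + axis c (- i) * v i) = v (- c)"
  proof (cases "c \<in> J")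
    case True
    have "(\<Sum>i\<in>J. axis c i * v (- i) + axis c (- i) * v i) = (\<Sum>i\<in>J. if i = c then v (- i) else 0)"
    proof (rule sum.cong[OF refl])
      fix i assume "i \<in> J"
      then have "i > 0" "c > 0" using True J_pos by auto
      then show "axis c i * v (- i) + axis c (- i) * v i = (if i = c then v (- i) else 0)"
        by (auto simp: axis_def)
    qed
    then show ?thesis using True finite_J by simp
  next
    case False
    then have c: "- c \<in> J" using assms by auto
    have "(\<Sum>i\<in>J. axis c i * v (- i) + axis c (- i) * v i) = (\<Sum>i\<in>J. if i = - c then v i else 0)"
      by (rule sum.cong) (use False in \<open>auto simp: axis_def\<close>)
    then show ?thesis using c finite_J by simp
  qed
  ultimately show ?thesis by (simp add: Bf_def)
qed

lemma Bf_axis_K: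
  assumes "c \<in> K"
  shows "Bf (axis c) v = BW (axis c) v"
proof -
  have "(\<Sum>i\<in>J. axis c i * v (- i) + axis c (- i) * v i) = 0"
    by (rule sum.neutral) (use assms in \<open>auto simp: axis_def\<close>)
  then show ?thesis by (simp add: Bf_def)
qed

lemma Qf_axis:
  assumes "c \<in> P"
  shows "Qf (axis c) = 0"
proof -
  have "QW (axis c) = 0" by (rule QW_zero) (use assms in \<open>auto simp: axis_def\<close>)
  moreover have "(\<Sum>i\<in>J. axis c i * axis c (- i)) = (0 :: 'a)"
    by (rule sum.neutral) (use J_pos in \<open>force simp: axis_def\<close>)
  ultimately show ?thesis by (simp add: Qf_def)
qed

lemma Qf_axis_K:
  assumes "c \<in> K"
  shows "Qf (axis c) = QW (axis c)"
proof -
  have "(\<Sum>i\<in>J. axis c i * axis c (- i)) = (0 :: 'a)"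
    by (rule sum.neutral) (use assms in \<open>auto simp: axis_def\<close>)
  then show ?thesis by (simp add: Qf_def)
qed

text \<open>\<open>Bf\<close> is the polar form of \<open>Qf\<close>, so an additive map that
  preserves \<open>Qf\<close> preserves \<open>Bf\<close> as well.\<close>

lemma isomI:
  assumes Q: "\<And>v. Qf (h v) = Qf v"
    and add: "\<And>v w. h (\<lambda>x. v x + w x) = (\<lambda>x. h v x + h w x)"
    and L: "\<And>v x. x \<notin> L \<Longrightarrow> h v x = v x"
    and inverse: "gen h'" "\<And>v. h' (h v) = v"
  shows "isom h"
proof -
  have "Bf (h v) (h w) = Bf v w" for v w
    using Qf_add[of "h v" "h w"] Qf_add[of v w] Q[of "\<lambda>x. v x + w x"] by (simp add: Q add)
  then show ?thesis unfolding isom_def using Q L inverse by (intro conjI allI impI exI[of _ h'])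
qed

text \<open>The Eichler transformation for the isotropic vector \<open>axis (- m)\<close> and the vector
  \<open>t * axis c\<close> orthogonal to it. Every elementary matrix of root type is of this form.\<close>

definition eichler :: "int \<Rightarrow> int \<Rightarrow> 'a \<Rightarrow> (int \<Rightarrow> 'a) \<Rightarrow> int \<Rightarrow> 'a" where
  "eichler c m t v = (\<lambda>x. v x + (if x = c then t * v m else 0)
     - (if x = - m then t * Bf (axis c) v + t\<^sup>2 * Qf (axis c) * v m else 0))"

text \<open>Adding \<open>p * axis c\<close> changes the form by
  \<open>p^2 * Qf (axis c) + p * Bf (axis c) v\<close>. Adding the isotropic vector
  \<open>q * axis (- m)\<close> changes it by \<open>q * v m\<close>, since \<open>c\<close> differs
  from \<open>m\<close>. The coefficient \<open>q\<close> is chosen to cancel the first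
  change.\<close>

lemma Qf_eichler:
  assumes "m \<in> P" "c \<noteq> m"
  shows "Qf (eichler c m t v) = Qf v"
proof -
  define p where "p = t * v m"
  define q where "q = - (t * Bf (axis c) v + t\<^sup>2 * Qf (axis c) * v m)"
  have m: "- m \<in> P" using assms(1) by auto
  have "eichler c m t v = (\<lambda>x. (p * axis c x + v x) + q * axis (- m) x)"
    by (rule ext) (simp add: eichler_def p_def q_def axis_def)
  then have "Qf (eichler c m t v) = Qf (\<lambda>x. p * axis c x + v x)
     + Bf (\<lambda>x. q * axis (- m) x) (\<lambda>x. p * axis c x + v x)"
    using Qf_add[of "\<lambda>x. p * axis c x + v x" "\<lambda>x. q * axis (- m) x"]
    by (simp add: Qf_scale Qf_axis[OF m] Bf_commute)
  also have "\<dots> = p\<^sup>2 * Qf (axis c) + Qf v + p * Bf (axis c) v + q * v m"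
    using assms Qf_add[of "\<lambda>x. p * axis c x" v]
    by (simp add: Qf_scale Bf_scale Bf_axis[OF m]) (simp add: axis_def)
  also have "\<dots> = Qf v" by (simp add: p_def q_def power2_eq_square algebra_simps)
  finally show ?thesis .
qed

lemma Bf_add_right: "Bf w (\<lambda>x. u x + v x) = Bf w u + Bf w v"
  using Bf_add by (simp add: Bf_commute[of w])

lemma Bf_scale_right: "Bf w (\<lambda>x. a * v x) = a * Bf w v"
  using Bf_scale by (simp add: Bf_commute[of w])

lemma Bf_axis_self: "Bf v v = 2 * Qf v"
  using Qf_add[of v v] Qf_scale[of 2 v] by (simp add: algebra_simps)

lemma eichler_inverse:
  assumes "m \<in> P" "c \<noteq> m" "c \<noteq> - m"
  shows "eichler c m (- t) (eichler c m t v) = v"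
proof
  fix x
  define p where "p = t * v m"
  define q where "q = - (t * Bf (axis c) v + t\<^sup>2 * Qf (axis c) * v m)"
  have m: "- m \<in> P" "m \<noteq> - m" using assms(1) J_pos by force+
  have e: "eichler c m t v = (\<lambda>x. (v x + p * axis c x) + q * axis (- m) x)"
    by (rule ext) (simp add: eichler_def p_def q_def axis_def)
  have ex: "eichler c m t v x = v x + (if x = c then t * v m else 0)
      - (if x = - m then t * Bf (axis c) v + t\<^sup>2 * Qf (axis c) * v m else 0)"
    by (simp add: eichler_def)
  have em: "eichler c m t v m = v m" using assms m by (simp add: eichler_def)
  have "Bf (axis c) (axis (- m)) = 0"
    using Bf_axis[OF m(1), of "axis c"] assms by (simp add: Bf_commute axis_def)
  \<comment> \<open>The mixed term contributes \<open>2 * t^2 * Qf (axis c) * v m\<close>, which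
    cancels the two terms of degree 2 in \<open>t\<close>.\<close>
  then have "Bf (axis c) (eichler c m t v) = Bf (axis c) v + p * (2 * Qf (axis c))"
    unfolding e by (simp add: Bf_add_right Bf_scale_right Bf_axis_self)
  then have "eichler c m (- t) (eichler c m t v) x = eichler c m t v x
      + (if x = c then - t * v m else 0)
      - (if x = - m then - t * (Bf (axis c) v + p * (2 * Qf (axis c))) + t\<^sup>2 * Qf (axis c) * v m else 0)"
    unfolding eichler_def[of c m "- t"] em by simp
  then show "eichler c m (- t) (eichler c m t v) x = v x"
    using assms(3) ex
    by (cases "x = c"; cases "x = - m") (simp_all add: p_def power2_eq_square algebra_simps)
qed

lemma shear_eichler:
  assumes "c \<in> L" "m \<in> P" "c \<noteq> m" "c \<noteq> - m" "gen (eichler c m (- t))"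
  shows "shear c m t (eichler c m t)"
proof -
  have "eichler c m t (\<lambda>x. v x + w x) = (\<lambda>x. eichler c m t v x + eichler c m t w x)" for v w
    by (rule ext) (simp add: eichler_def Bf_add_right algebra_simps)
  moreover have "eichler c m t v x = v x" if "x \<notin> L" for v x
  proof -
    have "- m \<in> L" using assms(2) J_L by auto
    then show ?thesis using that assms(1) by (auto simp: eichler_def)
  qed
  ultimately have "isom (eichler c m t)"
    using assms eichler_inverse[OF assms(2,3,4)] Qf_eichler[OF assms(2,3)] by (intro isomI) auto
  moreover have "eichler c m t v = v"
    if "v m = 0" "c \<in> P \<longrightarrow> v (- c) = 0" "\<forall>x\<in>K. v x = 0" for v
  proof -
    have "Bf (axis c) v = 0"
    proof (cases "c \<in> P")
      case True
      then show ?thesis using that Bf_axis by simp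
    next
      case False
      then have "c \<in> K" using assms(1) by simp
      have "BW v (axis c) = 0" by (rule BW_zero) (use that in simp)
      then show ?thesis using Bf_axis_K[OF \<open>c \<in> K\<close>] BW_commute by simp
    qed
    then show ?thesis using that by (intro ext) (simp add: eichler_def)
  qed
  ultimately show ?thesis
    using assms(4) unfolding shear_def by (intro conjI allI impI) (simp_all add: eichler_def)
qed

text \<open>The reflection in the vector \<open>axis i - axis (- i)\<close>, which is the action of
  \<open>w_mat\<close>.\<close>

definition swap :: "int \<Rightarrow> (int \<Rightarrow> 'a) \<Rightarrow> int \<Rightarrow> 'a" where
  "swap i v = (\<lambda>x. if x = i then v (- i) else if x = - i then v i else v x)"

lemma isom_swap:
  assumes "i \<in> J" "gen (swap i)"
  shows "isom (swap i)"
proof (rule isomI[OF _ _ _ assms(2)])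
  fix v w :: "int \<Rightarrow> 'a" and x :: int
  have "QW (swap i v) = QW v" by (rule QW_local) (use assms(1) in \<open>auto simp: swap_def\<close>)
  moreover have "(\<Sum>j\<in>J. swap i v j * swap i v (- j)) = (\<Sum>j\<in>J. v j * v (- j))"
    by (rule sum.cong) (auto simp: swap_def)
  ultimately show "Qf (swap i v) = Qf v" by (simp add: Qf_def)
  show "swap i (\<lambda>x. v x + w x) = (\<lambda>x. swap i v x + swap i w x)"
    by (auto simp: swap_def)
  show "swap i (swap i v) = v" by (auto simp: swap_def)
  show "swap i v x = v x" if "x \<notin> L"
    using that assms(1) J_L by (auto simp: swap_def)
qed

section \<open>Column families of orthogonal matrices\<close>

definition vfun :: "'a vec \<Rightarrow> int \<Rightarrow> 'a" where
  "vfun x a = (if a \<in> L then x $ pos a else 0)"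

text \<open>Columns are images of unit vectors, and the values of \<open>Bf\<close> come from
  evaluating \<open>Qf\<close> on sums of two of them.\<close>

lemma iso_family_columns:
  assumes g: "g \<in> orth_group d q" and q: "\<forall>x\<in>carrier_vec d. q x = Qf (vfun x)"
  shows "iso_family (columns g)"
proof -
  have gc: "g \<in> carrier_mat d d" using g by (simp add: orth_group_def GL_def)
  let ?u = "\<lambda>b. unit_vec d (pos b) :: 'a vec"
  have col: "columns g b = vfun (g *\<^sub>v ?u b)" if "b \<in> L" for b
  proof
    fix a
    show "columns g b a = vfun (g *\<^sub>v ?u b) a"
      using gc pos_less[of a] pos_less[OF that] by (simp add: columns_def vfun_def)
  qed
  have unit: "vfun (?u b) = axis b" if "b \<in> L" for b
    using that pos_less[of b] pos_less pos_eq_iff by (auto simp: vfun_def axis_def)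
  have add: "vfun (x + y) = (\<lambda>a. vfun x a + vfun y a)" if "x \<in> carrier_vec d" "y \<in> carrier_vec d" for x y
    using that pos_less by (auto simp: vfun_def)
  have pres: "Qf (vfun (g *\<^sub>v x)) = Qf (vfun x)" if "x \<in> carrier_vec d" for x
    using g that gc q mult_mat_vec_carrier[OF gc that] by (simp add: orth_group_def)
  have Q: "Qf (columns g b) = Qf (axis b)" if "b \<in> L" for b
    using pres[of "?u b"] col unit that by simp
  have B: "Bf (columns g b) (columns g c) = Bf (axis b) (axis c)" if "b \<in> L" "c \<in> L" for b c
  proof -
    have "vfun (g *\<^sub>v (?u b + ?u c)) = (\<lambda>a. columns g b a + columns g c a)"
      using that gc by (simp add: col add mult_add_distrib_mat_vec)
    then have "Qf (\<lambda>a. columns g b a + columns g c a) = Qf (\<lambda>a. axis b a + axis c a)"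
      using pres[of "?u b + ?u c"] that by (simp add: add unit)
    then show ?thesis using Q that by (simp add: Qf_add)
  qed
  show ?thesis unfolding iso_family_def using Q B by (simp add: columns_def)
qed

section \<open>Matching Eichler transformations with elementary matrices\<close>

lemma eichler_P:
  assumes "c \<in> P"
  shows "eichler c m t v = (\<lambda>x. v x + (if x = c then t * v m else 0) - (if x = - m then t * v (- c) else 0))"
  by (rule ext) (simp add: eichler_def Bf_axis[OF assms] Qf_axis[OF assms])

lemma eichler_K:
  assumes "c \<in> K"
  shows "eichler c m t v = (\<lambda>x. v x + (if x = c then t * v m else 0)
    - (if x = - m then t * BW (axis c) v + t\<^sup>2 * QW (axis c) * v m else 0))"
  by (rule ext) (simp add: eichler_def Bf_axis_K[OF assms] Qf_axis_K[OF assms])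

lemma Qf_eq_QW:
  assumes "\<And>x. x \<notin> K \<Longrightarrow> v x = 0"
  shows "Qf v = QW v"
proof -
  have "(\<Sum>i\<in>J. v i * v (- i)) = 0" by (rule sum.neutral) (use assms in auto)
  then show ?thesis by (simp add: Qf_def)
qed

lemma Bf_eq_BW:
  assumes "\<And>x. x \<notin> K \<Longrightarrow> v x = 0"
  shows "Bf v w = BW v w"
proof -
  have "(\<Sum>i\<in>J. v i * w (- i) + v (- i) * w i) = 0" by (rule sum.neutral) (use assms in auto)
  then show ?thesis by (simp add: Bf_def)
qed

text \<open>For labels in \<open>P\<close> the maps \<open>eichler c m t\<close> and
  \<open>eichler (- m) (- c) (- t)\<close> coincide. Hence the listed matrices, with their
  restrictions on signs and on the order of the indices, reach all pairs of labels, at the price of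
  a sign of \<open>t\<close>.\<close>

lemma gen_eichler_common:
  assumes E: "elem_common d (mat_unit d pos) J \<subseteq> E" and "c \<in> P" "m \<in> P" "c \<noteq> m" "c \<noteq> - m"
  shows "gen (eichler c m t)"
proof -
  have L: "i \<in> L" "- i \<in> L" if "i \<in> J" for i using that J_L by auto
  have pp: "gen (eichler i j t)" if "i \<in> J" "j \<in> J" "i \<noteq> j" for i j t
    by (rule gen_elemI[OF subsetD[OF E elem_common.pos_pos[OF that, where t = t]]],
        (rule acts_intros | (use that L in \<open>auto simp: eichler_P algebra_simps\<close>)[1])+)
  have pn: "gen (eichler i (- j) t)" if "i \<in> J" "j \<in> J" "i < j" for i j t
    by (rule gen_elemI[OF subsetD[OF E elem_common.pos_neg[OF that, where t = t]]],
        (rule acts_intros | (use that L in \<open>auto simp: eichler_P algebra_simps\<close>)[1])+)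
  have pn': "gen (eichler i (- j) t)" if "i \<in> J" "j \<in> J" "j < i" for i j t
    by (rule gen_elemI[OF subsetD[OF E elem_common.pos_neg[OF that(2,1,3), where t = "- t"]]],
        (rule acts_intros | (use that L in \<open>auto simp: eichler_P algebra_simps\<close>)[1])+)
  have np: "gen (eichler (- i) j t)" if "i \<in> J" "j \<in> J" "i < j" for i j t
    by (rule gen_elemI[OF subsetD[OF E elem_common.neg_pos[OF that, where t = t]]],
        (rule acts_intros | (use that L in \<open>auto simp: eichler_P algebra_simps\<close>)[1])+)
  have np': "gen (eichler (- i) j t)" if "i \<in> J" "j \<in> J" "j < i" for i j t
    by (rule gen_elemI[OF subsetD[OF E elem_common.neg_pos[OF that(2,1,3), where t = "- t"]]],
        (rule acts_intros | (use that L in \<open>auto simp: eichler_P algebra_simps\<close>)[1])+)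
  have nn: "gen (eichler (- i) (- j) t)" if "i \<in> J" "j \<in> J" "i \<noteq> j" for i j t
    by (rule gen_elemI[OF subsetD[OF E elem_common.pos_pos[OF that(2,1) that(3)[symmetric], where t = "- t"]]],
        (rule acts_intros | (use that L in \<open>auto simp: eichler_P algebra_simps\<close>)[1])+)
  consider i j where "c = i" "m = j" "i \<in> J" "j \<in> J" | i j where "c = - i" "m = j" "i \<in> J" "j \<in> J"
    | i j where "c = i" "m = - j" "i \<in> J" "j \<in> J" | i j where "c = - i" "m = - j" "i \<in> J" "j \<in> J"
    using assms(2,3) by blast
  then show ?thesis
  proof cases
    case 1
    then show ?thesis using pp assms(4) by blast
  next
    case 2
    then have "i \<noteq> j" using assms(5) by simp
    then show ?thesis using 2 np[of i j t] np'[of i j t] by (cases "i < j") auto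
  next
    case 3
    then have "i \<noteq> j" using assms(5) by simp
    then show ?thesis using 3 pn[of i j t] pn'[of i j t] by (cases "i < j") auto
  next
    case 4
    then show ?thesis using nn assms(4) by blast
  qed
qed

lemma gen_swap_w_mat:
  assumes "w_mat d (mat_unit d pos) i \<in> E" "i \<in> J"
  shows "gen (swap i)"
proof -
  have "swap i = (\<lambda>v x. if x = i then v (- i) else if x = - i then v i else v x)"
    by (intro ext) (simp add: swap_def)
  then show ?thesis using gen_w_mat[OF assms(1)] assms(2) J_L J_pos[of i] by auto
qed

lemma acts_vfun:
  assumes "acts A h" "x \<in> carrier_vec d" "a \<in> L"
  shows "vfun (A *\<^sub>v x) a = h (vfun x) a"
proof -
  have A: "A \<in> carrier_mat d d" using assms(1) by (simp add: acts_def)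
  have a: "pos a < d" using pos_less[OF assms(3)] .
  \<comment> \<open>\<open>acts\<close> speaks of families of \<open>d\<close> columns, so the
    vector is repeated in all of them; column 0 exists because \<open>pos a < d\<close>.\<close>
  have "col (cmat (\<lambda>b. vfun x)) 0 = x"
    using assms(2) a by (intro eq_vecI) (auto simp: cmat_def vfun_def)
  then have "vfun (A *\<^sub>v x) a = (A * cmat (\<lambda>b. vfun x)) $$ (pos a, 0)"
    using assms(2,3) A a by (simp add: vfun_def cmat_def)
  also have "A * cmat (\<lambda>b. vfun x) = cmat (\<lambda>b. h (vfun x))"
    using assms(1) by (simp add: acts_def)
  also have "\<dots> $$ (pos a, 0) = h (vfun x) a"
    using a assms(3) by (simp add: cmat_def)
  finally show ?thesis .
qed

text \<open>Meant for \<open>x_A0\<close>, which counts as elementary only if it lies in the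
  group.\<close>

lemma orth_groupI:
  assumes "acts A h" "acts A' h'" "\<And>v. h (h' v) = v" "\<And>v. h' (h v) = v"
    and q: "\<forall>x\<in>carrier_vec d. q x = Qf (vfun x)"
    and h: "\<And>v. Qf (h v) = Qf v" "\<And>v x. x \<notin> L \<Longrightarrow> h v x = v x"
  shows "A \<in> orth_group d q"
proof -
  have A: "A \<in> carrier_mat d d" "A' \<in> carrier_mat d d" using assms(1,2) by (simp_all add: acts_def)
  have "A * A' = 1\<^sub>m d" "A' * A = 1\<^sub>m d" using acts_inverse_eq assms(1-4) by blast+
  then have "invertible_mat A" using A by (auto simp: invertible_mat_def inverts_mat_def)
  moreover have "q (A *\<^sub>v x) = q x" if x: "x \<in> carrier_vec d" for x
  proof -
    have "vfun (A *\<^sub>v x) = h (vfun x)"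
    proof
      fix a
      show "vfun (A *\<^sub>v x) a = h (vfun x) a"
      proof (cases "a \<in> L")
        case True
        then show ?thesis by (rule acts_vfun[OF assms(1) x])
      next
        case False
        then have "h (vfun x) a = vfun x a" by (rule h(2))
        then show ?thesis using False by (simp add: vfun_def)
      qed
    qed
    then show ?thesis using q h(1) x mult_mat_vec_carrier[OF A(1) x] by simp
  qed
  ultimately show ?thesis using A by (simp add: orth_group_def GL_def)
qed

end

text \<open>The last assumption serves to move \<open>axis (- m)\<close> to a vector with nonzero coordinate at \<open>m\<close>:
  there are no elements \<open>w\<^sub>i\<close> in odd dimension, where an Eichler transformation by an
  anisotropic vector does this.\<close>

locale orthogonal_reduction = quadratic_space d L pos E J QW BW
  for d L pos and E :: "'a::field mat set" and J QW BW +
  assumes gen_eichler: "\<And>c m t. \<lbrakk>c \<in> L; m \<in> P; c \<noteq> m; c \<noteq> - m\<rbrakk> \<Longrightarrow> gen (eichler c m t)"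
    and gen_swap: "\<And>m. m \<in> J \<Longrightarrow> gen (swap m)
      \<or> (\<exists>c\<in>L - (J \<union> uminus ` J). QW (axis c) \<noteq> 0 \<and> (\<forall>v. QW v = 0 \<longrightarrow> BW (axis c) v = 0))"
begin

lemma ex_shear_eichler:
  assumes "c \<in> L" "m \<in> P" "c \<noteq> m" "c \<noteq> - m"
  shows "shear c m t (eichler c m t)"
  using shear_eichler gen_eichler assms by auto

text \<open>An Eichler transformation with pivot \<open>- m\<close> writes
  \<open>- (BW (axis c) v + QW (axis c) * v (- m))\<close> into position \<open>m\<close>. If
  \<open>v (- m) = 0\<close>, then \<open>v\<close> lives on \<open>K\<close>, and since it is not
  in the radical some \<open>c\<close> makes the first term nonzero. If \<open>v (- m)\<close> is
  nonzero, either \<open>swap\<close> moves it to \<open>m\<close>, or there is an anisotropic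
  \<open>c\<close> for which the first term vanishes; this uses \<open>QW v = 0\<close>, which
  follows from isotropy because \<open>v m = 0\<close>.\<close>

lemma start_orthogonal:
  assumes m: "m \<in> J" and v: "v m = 0" "\<And>x. x \<noteq> - m \<Longrightarrow> x \<notin> K \<Longrightarrow> v x = 0" and Q: "Qf v = 0"
    and B: "Bf v w \<noteq> 0"
  shows "\<exists>h. isom h \<and> fixes_off (insert m (insert (- m) K)) h \<and> h v m \<noteq> 0"
proof -
  have mP: "- m \<in> P" and mn: "m \<noteq> - m" using m J_pos[OF m] by auto
  have P0: "v x * v (- x) = 0" if "x \<in> J" for x
    using v(1) v(2)[of x] that J_pos[OF that] J_pos[OF m] by (cases "x = m") auto
  have QW0: "QW v = 0"
  proof -
    have "(\<Sum>i\<in>J. v i * v (- i)) = 0" by (rule sum.neutral) (use P0 in auto)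
    then show ?thesis using Q by (simp add: Qf_def)
  qed
  have mK: "m \<notin> K" "- m \<notin> K" using m by auto
  have *: "\<exists>h. isom h \<and> fixes_off (insert m (insert (- m) K)) h \<and> h v m \<noteq> 0"
    if c: "c \<in> K" and ne: "BW (axis c) v + QW (axis c) * v (- m) \<noteq> 0" for c
  proof -
    have cm: "c \<in> L" "c \<noteq> - m" "c \<noteq> - (- m)" using c mK by auto
    have s: "shear c (- m) 1 (eichler c (- m) 1)" using ex_shear_eichler[OF cm(1) mP cm(2,3)] .
    have "eichler c (- m) 1 v m = - (BW (axis c) v + QW (axis c) * v (- m))"
      using v(1) cm by (simp add: eichler_def Bf_axis_K[OF c] Qf_axis_K[OF c])
    then have "eichler c (- m) 1 v m \<noteq> 0" using ne by (metis neg_equal_0_iff_equal)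
    moreover have "isom (eichler c (- m) 1)" using s by (simp add: shear_def)
    moreover have "fixes_off (insert m (insert (- m) K)) (eichler c (- m) 1)"
      unfolding fixes_off_def
    proof (intro allI impI)
      fix u :: "int \<Rightarrow> 'a" assume u: "\<forall>x\<in>insert m (insert (- m) K). u x = 0"
      have "u (- m) = 0" "c \<in> P \<longrightarrow> u (- c) = 0" "\<forall>x\<in>K. u x = 0" using u c by simp_all
      then show "eichler c (- m) 1 u = u" using s unfolding shear_def by (elim conjE) simp
    qed
    ultimately show ?thesis by (intro exI[of _ "eichler c (- m) 1"] conjI)
  qed
  show ?thesis
  proof (cases "v (- m) = 0")
    case True
    then have "v x = 0" if "x \<notin> K" for x using that v(2) by (cases "x = - m") auto
    then have "(\<Sum>i\<in>J. v i * w (- i) + v (- i) * w i) = 0" by (intro sum.neutral) auto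
    then have "BW v w \<noteq> 0" using B by (simp add: Bf_def)
    then obtain c where "c \<in> K" "BW (axis c) v \<noteq> 0" using BW_expand by blast
    then show ?thesis using * True by simp
  next
    case False
    show ?thesis
    proof (cases "gen (swap m)")
      case True
      have "swap m v m \<noteq> 0" using False by (simp add: swap_def)
      moreover have "fixes_off (insert m (insert (- m) K)) (swap m)"
        unfolding fixes_off_def by (auto simp: swap_def)
      ultimately show ?thesis using isom_swap[OF m True] by (intro exI[of _ "swap m"] conjI)
    next
      case nswap: False
      then obtain c where "c \<in> K" "QW (axis c) \<noteq> 0" "BW (axis c) v = 0"
        using gen_swap[OF m] QW0 by blast
      then show ?thesis using * False by simp
    qed
  qed
qed

lemma Qf_plane:
  assumes m: "m \<in> P" and v: "\<And>x. x \<noteq> m \<Longrightarrow> x \<noteq> - m \<Longrightarrow> v x = 0"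
  shows "Qf v = v m * v (- m)"
proof -
  have m': "- m \<in> P" using m by auto
  have "v = (\<lambda>x. v m * axis m x + v (- m) * axis (- m) x)"
    using v J_pos m by (force simp: axis_def)
  then have "Qf v = v m * (v (- m) * Bf (axis m) (axis (- m)))"
    using Qf_add[of "\<lambda>x. v m * axis m x" "\<lambda>x. v (- m) * axis (- m) x"]
    by (simp add: Qf_scale Bf_scale Bf_scale_right Qf_axis[OF m] Qf_axis[OF m'])
  then show ?thesis using Bf_axis[OF m] by (simp add: axis_def)
qed

sublocale witt_reduction d L pos E J Bf Qf "\<lambda>_. 1" False
proof unfold_locales
  fix c m t assume "c \<in> L" "m \<in> P" "c \<noteq> m" "c \<noteq> - m \<or> False"
  then show "\<exists>h. shear c m t h" using ex_shear_eichler by blast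
qed (use Bf_axis Bf_scale Qf_axis Qf_plane start_orthogonal in simp_all)

lemma orthogonal_decomposition:
  assumes "l \<in> J" "g \<in> orth_group d q" "\<forall>x\<in>carrier_vec d. q x = Qf (vfun x)"
  shows "\<exists>es F a. set es \<subseteq> E \<and> g = mat_prod d es * cmat F \<and> iso_family F \<and> a \<noteq> 0
    \<and> (\<forall>b\<in>P - {l, - l}. F b = axis b) \<and> F l = (\<lambda>x. a * axis l x)
    \<and> F (- l) = (\<lambda>x. inverse a * axis (- l) x) \<and> (\<forall>b\<in>K. \<forall>x. x \<notin> K \<longrightarrow> F b x = 0)"
proof -
  have "g \<in> carrier_mat d d" using assms(2) by (simp add: orth_group_def GL_def)
  then have "cmat (columns g) = g" by (rule cmat_columns)
  with reduce[OF assms(1) iso_family_columns[OF assms(2,3)]] show ?thesis by simp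
qed

end

section \<open>Positions of the signed labels, and the plus type\<close>

lemma bij_pos_even:
  "bij_betw (pos_even l) ({1..int l} \<union> uminus ` {1..int l}) {..<2 * l}"
  by (rule bij_betw_byWitness[where f' = "\<lambda>n. if n < l then int n + 1 else int l - int n - 1"])
    (auto simp: pos_even_def)

lemma bij_pos_odd:
  "bij_betw (pos_odd l) (insert 0 ({1..int l} \<union> uminus ` {1..int l})) {..<2 * l + 1}"
  by (rule bij_betw_byWitness[where f' = "\<lambda>n. if n \<le> l then int n else int l - int n"])
    (auto simp: pos_odd_def image_iff Ball_def split: if_splits)

lemma bij_pos_minus:
  assumes "l \<ge> 2"
  shows "bij_betw (pos_minus l) (insert 1 (insert (- 1) ({2..int l} \<union> uminus ` {2..int l}))) {..<2 * l}"
  by (rule bij_betw_byWitness[where f' = "\<lambda>n. if n = 0 then 1 else if n = 1 then - 1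
      else if n \<le> l then int n else int l - int n - 1"])
    (use assms in \<open>auto simp: pos_minus_def\<close>)

lemma O_plus_decomposition:
  fixes g :: "'a::field mat"
  assumes "l \<ge> 1" "g \<in> O_plus l"
  shows "\<exists>es c. set es \<subseteq> elem_O_plus l \<and> c \<noteq> 0 \<and> g = mat_prod (2 * l) es * diag_plus l c"
proof -
  \<comment> \<open>Otherwise the image of the interval under \<open>uminus\<close> would be
    rewritten to an interval and no longer match the form in which the locales write the
    labels.\<close>
  note image_uminus_atLeastAtMost [simp del]
  let ?J = "{1..int l}"
  let ?L = "?J \<union> uminus ` ?J"
  have carrier: "elem_O_plus l \<subseteq> (carrier_mat (2 * l) (2 * l) :: 'a mat set)"
    by (auto elim!: elem_O_plus.cases elem_common.cases simp: w_mat_def mat_unit_def)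
  interpret quadratic_space "2 * l" ?L "pos_even l" "elem_O_plus l :: 'a mat set" ?J "\<lambda>v. 0" "\<lambda>v w. 0"
    by unfold_locales (use bij_pos_even carrier in auto)
  \<comment> \<open>A second interpretation, because its assumptions speak of \<open>gen\<close>,
    \<open>eichler\<close> and \<open>swap\<close> as provided by the first.\<close>
  interpret orthogonal_reduction "2 * l" ?L "pos_even l" "elem_O_plus l :: 'a mat set" ?J "\<lambda>v. 0" "\<lambda>v w. 0"
  proof unfold_locales
    fix c m t assume "c \<in> ?L" "m \<in> ?L" "c \<noteq> m" "c \<noteq> - m"
    then show "gen (eichler c m t)"
      by (intro gen_eichler_common) (auto intro: elem_O_plus.common)
  next
    fix m assume "m \<in> ?J"
    then have "gen (swap m)" by (intro gen_swap_w_mat elem_O_plus.w)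
    then show "gen (swap m) \<or> (\<exists>c\<in>?L - ?L. (0 :: 'a) \<noteq> 0 \<and> (\<forall>v :: int \<Rightarrow> 'a. (0 :: 'a) = 0 \<longrightarrow> (0 :: 'a) = 0))" by blast
  qed
  have q: "\<forall>x\<in>carrier_vec (2 * l). Q_plus l x = Qf (vfun x)"
    unfolding Q_plus_def Qf_def by (auto simp: vfun_def intro!: sum.cong)
  have l: "int l \<in> ?J" using assms by simp
  obtain es F a where F: "set es \<subseteq> elem_O_plus l" "g = mat_prod (2 * l) es * cmat F"
    "iso_family F" "a \<noteq> 0" "\<forall>b\<in>?L - {int l, - int l}. F b = axis b"
    "F (int l) = (\<lambda>x. a * axis (int l) x)" "F (- int l) = (\<lambda>x. inverse a * axis (- int l) x)"
    "\<forall>b\<in>?L - ?L. \<forall>x. x \<notin> ?L - ?L \<longrightarrow> F b x = 0"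
    using orthogonal_decomposition[OF l assms(2)[unfolded O_plus_def] q] by (elim exE conjE) (rule that)
  have "cmat F = cmat (\<lambda>b x. (if b = int l then a else if b = - int l then inverse a else 1) * axis b x)"
    by (rule cmat_cong) (use F(5-7) in auto)
  also have "\<dots> = diag_plus l a"
    unfolding cmat_diag diag_plus_def mat_diag_def
    by (rule cong_mat) (use l in \<open>auto simp: lab_eq_iff\<close>)
  finally show ?thesis using F(1,2,4) by (intro exI[of _ es] exI[of _ a]) simp
qed

section \<open>Odd dimension\<close>

lemma char2_two_eq_0: "CHAR('a::field) = 2 \<Longrightarrow> (2 :: 'a) = 0"
  using of_nat_CHAR[where ?'a = 'a] by simp

text \<open>Reconciles the minus sign in \<open>eichler\<close> with the plus signs of the matrices
  for characteristic 2.\<close>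

lemma char2_diff:
  assumes "CHAR('a::field) = 2"
  shows "x - y = x + (y :: 'a)"
proof -
  have "y + y = 2 * y" by simp
  also have "\<dots> = 0" by (simp add: char2_two_eq_0[OF assms])
  finally show ?thesis by (simp add: eq_neg_iff_add_eq_0 diff_conv_add_uminus del: add_uminus_conv_diff)
qed

text \<open>The only label without partner is 0, so the residual isometry is a scalar of square 1,
  which is \<open>\<theta>\<close>. In every characteristic \<open>axis 0\<close> is anisotropic and
  \<open>QW v = 0\<close> forces \<open>v 0 = 0\<close>; this gives the substitute for
  \<open>swap\<close>.\<close>

lemma O_odd_decomposition:
  fixes g :: "'a::field mat"
  assumes "l \<ge> 1" "g \<in> O_odd l"
  shows "\<exists>es \<theta> c. set es \<subseteq> elem_O_odd l \<and> c \<noteq> 0 \<and> (\<theta> = 1 \<or> \<theta> = - 1)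
    \<and> g = mat_prod (2 * l + 1) es * diag_odd l \<theta> c"
proof -
  note image_uminus_atLeastAtMost [simp del]
  let ?J = "{1..int l}"
  let ?P = "?J \<union> uminus ` ?J"
  let ?L = "insert 0 ?P"
  let ?Q = "\<lambda>v :: int \<Rightarrow> 'a. (v 0)\<^sup>2"
  let ?B = "\<lambda>v w :: int \<Rightarrow> 'a. 2 * v 0 * w 0"
  have K: "?L - ?P = {0}" by auto
  have carrier: "elem_O_odd l \<subseteq> (carrier_mat (2 * l + 1) (2 * l + 1) :: 'a mat set)"
    by (auto elim!: elem_O_odd.cases elem_common.cases simp: mat_unit_def)
  interpret quadratic_space "2 * l + 1" ?L "pos_odd l" "elem_O_odd l :: 'a mat set" ?J ?Q ?B
  proof unfold_locales
    show "bij_betw (pos_odd l) ?L {..<2 * l + 1}" by (rule bij_pos_odd)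
    show "?Q v = ?Q w" if "\<And>x. x \<in> ?L - ?P \<Longrightarrow> v x = w x" for v w using that[of 0] K by auto
    show "\<exists>c\<in>?L - ?P. ?B (axis c) v \<noteq> 0" if "?B v w \<noteq> 0" for v w
      using that unfolding K by (auto simp: axis_def)
  qed (use carrier in \<open>auto simp: power2_eq_square algebra_simps\<close>)
  have e0: "eichler 0 m t v = (\<lambda>x. v x + (if x = 0 then t * v m else 0)
    - (if x = - m then t * (2 * v 0) + t\<^sup>2 * v m else 0))" for m t v
    by (subst eichler_K) (auto simp: axis_def)
  have L: "i \<in> ?L" "- i \<in> ?L" "i \<noteq> 0" if "i \<in> ?J" for i using that by auto
  have g0: "gen (eichler 0 i t) \<and> gen (eichler 0 (- i) t)" if i: "i \<in> ?J" for i t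
  proof (cases "CHAR('a) = 2")
    case True
    have e1: "eichler 0 m t v = (\<lambda>x. v x + (if x = 0 then t * v m else 0)
      + (if x = - m then t\<^sup>2 * v m else 0))" for m t v
      by (subst e0) (simp only: char2_two_eq_0[OF True] char2_diff[OF True] mult_zero_left mult_zero_right add_0)
    have "gen (eichler 0 i t)"
      by (rule gen_elemI[OF elem_O_odd.x_0_i_char2[OF True i, of t]],
          (rule acts_intros L(1,2)[OF i] insertI1 | (use L(3)[OF i] in \<open>simp only: e1, simp\<close>)[1])+)
    moreover have "gen (eichler 0 (- i) t)"
      by (rule gen_elemI[OF elem_O_odd.x_i_0_char2[OF True i, of t]],
          (rule acts_intros L(1,2)[OF i] insertI1 | (use L(3)[OF i] in \<open>simp only: e1, simp\<close>)[1])+)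
    ultimately show ?thesis ..
  next
    case False
    have "gen (eichler 0 i t)"
      by (rule gen_elemI[OF elem_O_odd.x_0_i[OF False i, of t]],
          (rule acts_intros L(1,2)[OF i] insertI1 | (use L(3)[OF i] in \<open>simp only: e0, simp\<close>)[1])+)
    \<comment> \<open>The parameter is \<open>- t\<close> because the matrix has \<open>- t\<close>
      at the place \<open>(0, - i)\<close>, where the Eichler transformation has
      \<open>t\<close>.\<close>
    moreover have "gen (eichler 0 (- i) t)"
      by (rule gen_elemI[OF elem_O_odd.x_i_0[OF False i, of "- t"]],
          (rule acts_intros L(1,2)[OF i] insertI1 | (use L(3)[OF i] in \<open>simp only: e0, simp\<close>)[1])+)
    ultimately show ?thesis ..
  qed
  interpret orthogonal_reduction "2 * l + 1" ?L "pos_odd l" "elem_O_odd l :: 'a mat set" ?J ?Q ?B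
  proof unfold_locales
    fix c m t assume *: "c \<in> ?L" "m \<in> ?P" "c \<noteq> m" "c \<noteq> - m"
    show "gen (eichler c m t)"
    proof (cases "c = 0")
      case True
      then show ?thesis using * g0 by auto
    next
      case False
      then show ?thesis using * by (intro gen_eichler_common) (auto intro: elem_O_odd.common)
    qed
  next
    fix m assume "m \<in> ?J"
    have "\<exists>c\<in>?L - ?P. ?Q (axis c) \<noteq> 0 \<and> (\<forall>v. ?Q v = 0 \<longrightarrow> ?B (axis c) v = 0)"
      unfolding K by (auto simp: axis_def)
    then show "gen (swap m) \<or> (\<exists>c\<in>?L - ?P. ?Q (axis c) \<noteq> 0 \<and> (\<forall>v. ?Q v = 0 \<longrightarrow> ?B (axis c) v = 0))" ..
  qed
  have q: "\<forall>x\<in>carrier_vec (2 * l + 1). Q_odd l x = Qf (vfun x)"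
    unfolding Q_odd_def Qf_def by (auto simp: vfun_def intro!: sum.cong)
  have l: "int l \<in> ?J" using assms by simp
  obtain es F a where F: "set es \<subseteq> elem_O_odd l" "g = mat_prod (2 * l + 1) es * cmat F"
    "iso_family F" "a \<noteq> 0" "\<forall>b\<in>?P - {int l, - int l}. F b = axis b"
    "F (int l) = (\<lambda>x. a * axis (int l) x)" "F (- int l) = (\<lambda>x. inverse a * axis (- int l) x)"
    "\<forall>b\<in>?L - ?P. \<forall>x. x \<notin> ?L - ?P \<longrightarrow> F b x = 0"
    using orthogonal_decomposition[OF l assms(2)[unfolded O_odd_def] q] by (elim exE conjE) (rule that)
  have F0: "F 0 x = 0" if "x \<noteq> 0" for x using F(8) that unfolding K by simp
  have Q0: "Qf v = (v 0)\<^sup>2" if "\<And>x. x \<noteq> 0 \<Longrightarrow> v x = 0" for v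
    by (rule Qf_eq_QW) (unfold K, use that in simp)
  have "Qf (F 0) = Qf (axis 0)" using F(3) by (simp add: iso_family_def)
  then have "(F 0 0)\<^sup>2 = 1" by (simp add: Q0 F0 axis_def)
  then have \<theta>: "F 0 0 = 1 \<or> F 0 0 = - 1" by (simp add: power2_eq_1_iff)
  have "cmat F = cmat (\<lambda>b x. (if b = 0 then F 0 0 else if b = int l then a
      else if b = - int l then inverse a else 1) * axis b x)"
    by (rule cmat_cong) (use F(5-7) F0 l in \<open>auto simp: axis_def\<close>)
  also have "\<dots> = diag_odd l (F 0 0) a"
    unfolding cmat_diag diag_odd_def mat_diag_def
    by (rule cong_mat) (use l in \<open>auto simp: lab_eq_iff\<close>)
  finally show ?thesis using F(1,2,4) \<theta>
    by (intro exI[of _ es] exI[of _ "F 0 0"] exI[of _ a]) simp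
qed

section \<open>Minus type, with characteristic 2 treated separately\<close>

lemma carrier_elem_common:
  "elem_common d (mat_unit d pos) J \<subseteq> carrier_mat d d"
  by (auto elim!: elem_common.cases simp: mat_unit_def)

text \<open>The residual isometry is a 2 by 2 matrix with first column \<open>(t, s)\<close>. Since
  \<open>x_1(t,s)\<close> is the isometry with this first column and determinant -1, the matrix is
  either \<open>x_1(t,s)\<close> or its product with \<open>x_2\<close>, which changes the sign of
  the second column.\<close>

lemma O_minus_decomposition:
  fixes g :: "'a::field mat"
  assumes "l \<ge> 2" "CHAR('a) \<noteq> 2" "\<epsilon> \<noteq> 0" "g \<in> O_minus l \<epsilon>"
  shows "\<exists>es c. set es \<subseteq> elem_O_minus l \<epsilon> \<and> c \<noteq> 0 \<and> g = mat_prod (2 * l) es * diag_minus l c"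
proof -
  note image_uminus_atLeastAtMost [simp del]
  let ?J = "{2..int l}"
  let ?P = "?J \<union> uminus ` ?J"
  let ?L = "insert 1 (insert (- 1) ?P)"
  let ?Q = "\<lambda>v :: int \<Rightarrow> 'a. (v 1)\<^sup>2 + \<epsilon> * (v (- 1))\<^sup>2"
  let ?B = "\<lambda>v w :: int \<Rightarrow> 'a. 2 * (v 1 * w 1) + 2 * (\<epsilon> * (v (- 1) * w (- 1)))"
  have K: "?L - ?P = {1, - 1}" by auto
  have two: "(2 :: 'a) \<noteq> 0"
  proof
    assume "(2 :: 'a) = 0"
    then have "of_nat 2 = (0 :: 'a)" by simp
    then have "CHAR('a) dvd 2" by (simp only: of_nat_eq_0_iff_char_dvd)
    then show False using assms(2) CHAR_not_1'[where ?'a = 'a]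
      by (metis One_nat_def dvd_imp_le le_neq_implies_less less_2_cases nat_neq_iff pos2 zero_neq_numeral dvd_0_left_iff)
  qed
  have carrier: "elem_O_minus l \<epsilon> \<subseteq> (carrier_mat (2 * l) (2 * l) :: 'a mat set)"
    using carrier_elem_common[of "2 * l" "pos_minus l" ?J, where ?'a = 'a]
    by (auto elim!: elem_O_minus.cases simp: mat_unit_def w_mat_def)
  interpret quadratic_space "2 * l" ?L "pos_minus l" "elem_O_minus l \<epsilon> :: 'a mat set" ?J ?Q ?B
  proof unfold_locales
    show "bij_betw (pos_minus l) ?L {..<2 * l}" by (rule bij_pos_minus[OF assms(1)])
    show "?Q v = ?Q w" if "\<And>x. x \<in> ?L - ?P \<Longrightarrow> v x = w x" for v w
      using that[of 1] that[of "- 1"] unfolding K by simp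
    show "\<exists>c\<in>?L - ?P. ?B (axis c) v \<noteq> 0" if "?B v w \<noteq> 0" for v w
      using that two assms(3) unfolding K by (auto simp: axis_def)
    show "elem_O_minus l \<epsilon> \<subseteq> carrier_mat (2 * l) (2 * l)" by (rule carrier)
  qed (simp_all add: power2_eq_square algebra_simps, auto)
  have e1: "eichler 1 m t v = (\<lambda>x. v x + (if x = 1 then t * v m else 0)
    - (if x = - m then t * (2 * v 1) + t\<^sup>2 * v m else 0))" for m t v
    by (rule ext, subst eichler_K) (unfold K, simp_all add: axis_def)
  have e2: "eichler (- 1) m t v = (\<lambda>x. v x + (if x = - 1 then t * v m else 0)
    - (if x = - m then t * (2 * (\<epsilon> * v (- 1))) + t\<^sup>2 * \<epsilon> * v m else 0))" for m t v
    by (rule ext, subst eichler_K) (unfold K, simp_all add: axis_def)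
  have L: "i \<in> ?L" "- i \<in> ?L" "i \<noteq> 1 \<and> i \<noteq> - 1 \<and> i \<noteq> - i" if "i \<in> ?J" for i using that by auto
  have L1: "1 \<in> ?L" "- 1 \<in> ?L" by simp_all
  have g1: "gen (eichler 1 i t)" if i: "i \<in> ?J" for i t
    by (rule gen_elemI[OF elem_O_minus.x_i_1[OF i, of t]],
        (rule acts_intros L(1,2)[OF i] L1 | (use L(3)[OF i] in \<open>simp only: e1, simp\<close>)[1])+)
  have g2: "gen (eichler 1 (- i) t)" if i: "i \<in> ?J" for i t
    by (rule gen_elemI[OF elem_O_minus.x_1_i[OF i, of "- t"]],
        (rule acts_intros L(1,2)[OF i] L1 | (use L(3)[OF i] in \<open>simp only: e1, simp\<close>)[1])+)
  have g3: "gen (eichler (- 1) i t)" if i: "i \<in> ?J" for i t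
    by (rule gen_elemI[OF elem_O_minus.x_i_m1[OF i, of t]],
        (rule acts_intros L(1,2)[OF i] L1 | (use L(3)[OF i] in \<open>simp only: e2, simp add: algebra_simps\<close>)[1])+)
  have g4: "gen (eichler (- 1) (- i) t)" if i: "i \<in> ?J" for i t
    by (rule gen_elemI[OF elem_O_minus.x_m1_i[OF i, of "- t"]],
        (rule acts_intros L(1,2)[OF i] L1 | (use L(3)[OF i] in \<open>simp only: e2, simp add: algebra_simps\<close>)[1])+)
  interpret orthogonal_reduction "2 * l" ?L "pos_minus l" "elem_O_minus l \<epsilon> :: 'a mat set" ?J ?Q ?B
  proof unfold_locales
    fix c m t assume *: "c \<in> ?L" "m \<in> ?P" "c \<noteq> m" "c \<noteq> - m"
    show "gen (eichler c m t)"
    proof (cases "c \<in> ?P")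
      case True
      then show ?thesis using * by (intro gen_eichler_common) (auto intro: elem_O_minus.common)
    next
      case False
      then have "c = 1 \<or> c = - 1" using * by blast
      then show ?thesis using * g1 g2 g3 g4 by blast
    qed
  next
    fix m assume "m \<in> ?J"
    then have "gen (swap m)" by (intro gen_swap_w_mat elem_O_minus.w)
    then show "gen (swap m) \<or> (\<exists>c\<in>?L - ?P. ?Q (axis c) \<noteq> 0 \<and> (\<forall>v. ?Q v = 0 \<longrightarrow> ?B (axis c) v = 0))" ..
  qed
  have q: "\<forall>x\<in>carrier_vec (2 * l). Q_minus l \<epsilon> x = Qf (vfun x)"
    unfolding Q_minus_def Qf_def by (auto simp: vfun_def intro!: sum.cong)
  have l: "int l \<in> ?J" using assms by simp
  obtain es F a where F: "set es \<subseteq> elem_O_minus l \<epsilon>" "g = mat_prod (2 * l) es * cmat F"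
    "iso_family F" "a \<noteq> 0" "\<forall>b\<in>?P - {int l, - int l}. F b = axis b"
    "F (int l) = (\<lambda>x. a * axis (int l) x)" "F (- int l) = (\<lambda>x. inverse a * axis (- int l) x)"
    "\<forall>b\<in>?L - ?P. \<forall>x. x \<notin> ?L - ?P \<longrightarrow> F b x = 0"
    using orthogonal_decomposition[OF l assms(4)[unfolded O_minus_def] q] by (elim exE conjE) (rule that)
  have FK: "F b x = 0" if "b = 1 \<or> b = - 1" "x \<noteq> 1" "x \<noteq> - 1" for b x
    using F(8) that unfolding K by auto
  have QK: "Qf v = ?Q v" if "\<And>x. x \<noteq> 1 \<Longrightarrow> x \<noteq> - 1 \<Longrightarrow> v x = 0" for v
    by (rule Qf_eq_QW) (unfold K, use that in simp)
  have BK: "Bf v w = ?B v w" if "\<And>x. x \<noteq> 1 \<Longrightarrow> x \<noteq> - 1 \<Longrightarrow> v x = 0" for v w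
    by (rule Bf_eq_BW) (unfold K, use that in simp)
  define t s p q where "t = F 1 1" and "s = F 1 (- 1)" and "p = F (- 1) 1" and "q = F (- 1) (- 1)"
  have "Qf (F 1) = Qf (axis 1)" "Qf (F (- 1)) = Qf (axis (- 1))" "Bf (F 1) (F (- 1)) = Bf (axis 1) (axis (- 1))"
    using F(3) by (simp_all add: iso_family_def)
  then have n1: "t\<^sup>2 + \<epsilon> * s\<^sup>2 = 1" and n2: "p\<^sup>2 + \<epsilon> * q\<^sup>2 = \<epsilon>" and "2 * (t * p) + 2 * (\<epsilon> * (s * q)) = 0"
    using FK by (simp_all add: QK BK axis_def t_def s_def p_def q_def)
  then have "2 * (t * p + \<epsilon> * (s * q)) = 0" by (simp only: distrib_left)
  then have n3: "t * p + \<epsilon> * (s * q) = 0" using two by (simp only: mult_eq_0_iff) simp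
  \<comment> \<open>The second column is \<open>\<delta>\<close> times \<open>(\<epsilon> s, - t)\<close>, which is orthogonal to the first column \<open>(t, s)\<close>.\<close>
  define \<delta> where "\<delta> = s * p - t * q"
  have n4: "t * p = - (\<epsilon> * (s * q))" using n3 by (simp add: eq_neg_iff_add_eq_0)
  \<comment> \<open>The factor 1 is there to be replaced by \<open>t^2 + \<epsilon> * s^2\<close>,
    the norm of the first column; orthogonality of the columns then produces
    \<open>\<delta>\<close>, the negative of the determinant.\<close>
  have "p * 1 = t * (t * p) + \<epsilon> * s\<^sup>2 * p"
    unfolding n1[symmetric] by (simp add: algebra_simps power2_eq_square)
  also have "\<dots> = \<epsilon> * s * \<delta>" unfolding n4 by (simp add: \<delta>_def algebra_simps power2_eq_square)
  finally have p: "p = \<epsilon> * s * \<delta>" by simp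
  have "q * 1 = t\<^sup>2 * q + s * (\<epsilon> * (s * q))"
    unfolding n1[symmetric] by (simp add: algebra_simps power2_eq_square)
  also have "\<epsilon> * (s * q) = - (t * p)" using n4 by simp
  also have "t\<^sup>2 * q + s * - (t * p) = - t * \<delta>" by (simp add: \<delta>_def algebra_simps power2_eq_square)
  finally have q': "q = - t * \<delta>" by simp
  \<comment> \<open>The second column has norm \<open>\<epsilon>\<close>; cancelling this nonzero
    factor leaves the condition on \<open>\<delta>\<close>.\<close>
  have "\<epsilon> * (t\<^sup>2 + \<epsilon> * s\<^sup>2) * \<delta>\<^sup>2 = \<epsilon>"
    using n2 unfolding p q' by (simp add: algebra_simps power2_eq_square)
  then have "\<delta>\<^sup>2 = 1" using assms(3) n1 by simp
  then have \<delta>: "\<delta> = 1 \<or> \<delta> = - 1" by (simp add: power2_eq_1_iff)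
  define h where "h = (\<lambda>(v :: int \<Rightarrow> 'a) x. if x = 1 then t * v 1 + p * v (- 1)
    else if x = - 1 then s * v 1 + q * v (- 1) else v x)"
  have h1: "gen (\<lambda>v x. if x = 1 then t * v 1 + \<epsilon> * s * v (- 1)
    else if x = - 1 then s * v 1 - t * v (- 1) else v x)" (is "gen ?h1")
    by (rule gen_elemI[OF elem_O_minus.x_1[OF n1]],
        (rule acts_intros L1 | (simp add: algebra_simps)[1])+)
  have h2: "gen (\<lambda>v x. if x = - 1 then - v (- 1) else v x)" (is "gen ?h2")
    by (rule gen_elemI[OF elem_O_minus.x_2], (rule acts_intros L1 | (simp)[1])+)
  have h: "gen h"
  proof (cases "\<delta> = 1")
    case True
    then have "h = ?h1" by (intro ext) (simp add: h_def p q')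
    then show ?thesis using h1 by simp
  next
    case False
    then have "\<delta> = - 1" using \<delta> by simp
    then have "h = (\<lambda>v. ?h1 (?h2 v))" by (intro ext) (simp add: h_def p q')
    then show ?thesis using gen_comp[OF h1 h2] by simp
  qed
  \<comment> \<open>The diagonal part. It is the identity on the labels \<open>1\<close> and
    \<open>- 1\<close>, which differ from \<open>l\<close> and \<open>- l\<close> because
    \<open>l\<close> is at least 2, so the block and \<open>D\<close> do not interfere.\<close>
  define D where "D b x = (if b = int l then a else if b = - int l then inverse a else 1) * axis b x" for b x
  have "cmat F = cmat (\<lambda>b. h (D b))"
  proof (rule cmat_cong)
    fix x b assume "x \<in> ?L" "b \<in> ?L"
    then consider "b = 1 \<or> b = - 1" | "b \<in> ?P" by blast
    then show "F b x = h (D b) x"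
    proof cases
      case 1
      have "int l \<noteq> 1" "- int l \<noteq> 1" "- 1 \<noteq> int l" "1 \<noteq> int l" "- 1 \<noteq> - int l" using assms(1) by auto
      then show ?thesis
        using 1 FK by (auto simp: h_def D_def axis_def t_def s_def p_def q_def)
    next
      case 2
      then have "b \<noteq> 1" "b \<noteq> - 1" by auto
      then have "h (D b) x = D b x" by (auto simp: h_def D_def axis_def)
      then show ?thesis using F(5-7) 2 by (auto simp: D_def)
    qed
  qed
  then have "\<exists>fs. set fs \<subseteq> elem_O_minus l \<epsilon> \<and> g = mat_prod (2 * l) fs * cmat D"
    using gen_mult[OF h F(1)] F(2) by simp
  moreover have "cmat D = diag_minus l a"
    unfolding D_def cmat_diag diag_minus_def mat_diag_def
    by (rule cong_mat) (use L(1,2)[OF l] in \<open>auto simp: lab_eq_iff\<close>)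
  ultimately show ?thesis using F(4) by metis
qed

text \<open>The residual isometry is itself an elementary matrix \<open>x_A0\<close>: the condition
  \<open>t * s + p * r = 1\<close> is the value of the polar form at its two columns.\<close>

lemma O_minus2_decomposition:
  fixes g :: "'a::field mat"
  assumes "l \<ge> 2" "CHAR('a) = 2" "g \<in> O_minus2 l \<alpha>"
  shows "\<exists>es c. set es \<subseteq> elem_O_minus2 l \<alpha> \<and> c \<noteq> 0 \<and> g = mat_prod (2 * l) es * diag_minus l c"
proof -
  note image_uminus_atLeastAtMost [simp del]
  let ?J = "{2..int l}"
  let ?P = "?J \<union> uminus ` ?J"
  let ?L = "insert 1 (insert (- 1) ?P)"
  let ?Q = "\<lambda>v :: int \<Rightarrow> 'a. \<alpha> * ((v 1)\<^sup>2 + (v (- 1))\<^sup>2) + v 1 * v (- 1)"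
  let ?B = "\<lambda>v w :: int \<Rightarrow> 'a. v 1 * w (- 1) + v (- 1) * w 1"
  have K: "?L - ?P = {1, - 1}" by auto
  note two = char2_two_eq_0[OF assms(2)] and diff = char2_diff[OF assms(2)]
  have sq: "(x + y)\<^sup>2 = x\<^sup>2 + y\<^sup>2" for x y :: 'a
    using two by (simp add: power2_sum)
  have carrier: "elem_O_minus2 l \<alpha> \<subseteq> (carrier_mat (2 * l) (2 * l) :: 'a mat set)"
    using carrier_elem_common[of "2 * l" "pos_minus l" ?J, where ?'a = 'a]
    by (auto elim!: elem_O_minus2.cases simp: mat_unit_def w_mat_def x_A0_def)
  interpret quadratic_space "2 * l" ?L "pos_minus l" "elem_O_minus2 l \<alpha> :: 'a mat set" ?J ?Q ?B
  proof unfold_locales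
    show "bij_betw (pos_minus l) ?L {..<2 * l}" by (rule bij_pos_minus[OF assms(1)])
    show "?Q v = ?Q w" if "\<And>x. x \<in> ?L - ?P \<Longrightarrow> v x = w x" for v w
      using that[of 1] that[of "- 1"] unfolding K by simp
    show "\<exists>c\<in>?L - ?P. ?B (axis c) v \<noteq> 0" if "?B v w \<noteq> 0" for v w
      using that unfolding K by (auto simp: axis_def)
    show "elem_O_minus2 l \<alpha> \<subseteq> carrier_mat (2 * l) (2 * l)" by (rule carrier)
    show "?Q (\<lambda>x. v x + w x) = ?Q v + ?Q w + ?B v w" for v w
      by (simp add: sq algebra_simps)
  qed (simp_all add: power2_eq_square algebra_simps, auto)
  have e1: "eichler 1 m t v = (\<lambda>x. v x + (if x = 1 then t * v m else 0)
    + (if x = - m then t * v (- 1) + t\<^sup>2 * \<alpha> * v m else 0))" for m t v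
    by (rule ext, subst eichler_K) (unfold K diff, simp_all add: axis_def)
  have e2: "eichler (- 1) m t v = (\<lambda>x. v x + (if x = - 1 then t * v m else 0)
    + (if x = - m then t * v 1 + t\<^sup>2 * \<alpha> * v m else 0))" for m t v
    by (rule ext, subst eichler_K) (unfold K diff, simp_all add: axis_def)
  have L: "i \<in> ?L" "- i \<in> ?L" "i \<noteq> 1 \<and> i \<noteq> - 1 \<and> i \<noteq> - i" if "i \<in> ?J" for i using that by auto
  have L1: "1 \<in> ?L" "- 1 \<in> ?L" by simp_all
  have g1: "gen (eichler 1 (- i) t)" if i: "i \<in> ?J" for i t
    by (rule gen_elemI[OF elem_O_minus2.x_1_mi[OF i, of t]],
        (rule acts_intros L(1,2)[OF i] L1 | (use L(3)[OF i] in \<open>simp only: e1, simp add: algebra_simps\<close>)[1])+)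
  have g2: "gen (eichler (- 1) (- i) t)" if i: "i \<in> ?J" for i t
    by (rule gen_elemI[OF elem_O_minus2.x_m1_mi[OF i, of t]],
        (rule acts_intros L(1,2)[OF i] L1 | (use L(3)[OF i] in \<open>simp only: e2, simp add: algebra_simps\<close>)[1])+)
  have w: "gen (swap i)" if "i \<in> ?J" for i
    using that by (intro gen_swap_w_mat elem_O_minus2.w)
  \<comment> \<open>The matrices mixing \<open>1\<close> or \<open>- 1\<close> with a pair have
    pivot \<open>- i\<close> only; conjugation by \<open>w_i\<close> yields those with pivot
    \<open>i\<close>.\<close>
  have conj: "gen (eichler c i t)" if i: "i \<in> ?J" and c: "c = 1 \<or> c = - 1" and g: "gen (eichler c (- i) t)" for c i t
  proof -
    have "eichler c i t = (\<lambda>v. swap i (eichler c (- i) t (swap i v)))"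
      using c L(3)[OF i] by (intro ext) (auto simp: e1 e2 swap_def)
    then show ?thesis using gen_comp[OF w[OF i] gen_comp[OF g w[OF i]]] by simp
  qed
  interpret orthogonal_reduction "2 * l" ?L "pos_minus l" "elem_O_minus2 l \<alpha> :: 'a mat set" ?J ?Q ?B
  proof unfold_locales
    fix c m t assume *: "c \<in> ?L" "m \<in> ?P" "c \<noteq> m" "c \<noteq> - m"
    show "gen (eichler c m t)"
    proof (cases "c \<in> ?P")
      case True
      then show ?thesis using * by (intro gen_eichler_common) (auto intro: elem_O_minus2.common)
    next
      case False
      then have c: "c = 1 \<or> c = - 1" using * by blast
      then have g: "gen (eichler c (- i) t)" if "i \<in> ?J" for i using that g1 g2 by blast
      then show ?thesis using *(2) conj[OF _ c g] by blast
    qed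
  next
    fix m assume "m \<in> ?J"
    then have "gen (swap m)" by (rule w)
    then show "gen (swap m) \<or> (\<exists>c\<in>?L - ?P. ?Q (axis c) \<noteq> 0 \<and> (\<forall>v. ?Q v = 0 \<longrightarrow> ?B (axis c) v = 0))" ..
  qed
  have q: "\<forall>x\<in>carrier_vec (2 * l). Q_minus2 l \<alpha> x = Qf (vfun x)"
    unfolding Q_minus2_def Qf_def by (auto simp: vfun_def intro!: sum.cong)
  have l: "int l \<in> ?J" using assms by simp
  obtain es F a where F: "set es \<subseteq> elem_O_minus2 l \<alpha>" "g = mat_prod (2 * l) es * cmat F"
    "iso_family F" "a \<noteq> 0" "\<forall>b\<in>?P - {int l, - int l}. F b = axis b"
    "F (int l) = (\<lambda>x. a * axis (int l) x)" "F (- int l) = (\<lambda>x. inverse a * axis (- int l) x)"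
    "\<forall>b\<in>?L - ?P. \<forall>x. x \<notin> ?L - ?P \<longrightarrow> F b x = 0"
    using orthogonal_decomposition[OF l assms(3)[unfolded O_minus2_def] q] by (elim exE conjE) (rule that)
  have FK: "F b x = 0" if "b = 1 \<or> b = - 1" "x \<noteq> 1" "x \<noteq> - 1" for b x
    using F(8) that unfolding K by auto
  have QK: "Qf v = ?Q v" if "\<And>x. x \<noteq> 1 \<Longrightarrow> x \<noteq> - 1 \<Longrightarrow> v x = 0" for v
    by (rule Qf_eq_QW) (unfold K, use that in simp)
  have BK: "Bf v w = ?B v w" if "\<And>x. x \<noteq> 1 \<Longrightarrow> x \<noteq> - 1 \<Longrightarrow> v x = 0" for v w
    by (rule Bf_eq_BW) (unfold K, use that in simp)
  define t r p s where "t = F 1 1" and "r = F 1 (- 1)" and "p = F (- 1) 1" and "s = F (- 1) (- 1)"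
  have "Qf (F 1) = Qf (axis 1)" "Qf (F (- 1)) = Qf (axis (- 1))" "Bf (F 1) (F (- 1)) = Bf (axis 1) (axis (- 1))"
    using F(3) by (simp_all add: iso_family_def)
  then have n1: "\<alpha> * (t\<^sup>2 + r\<^sup>2) + t * r = \<alpha>" and n2: "\<alpha> * (p\<^sup>2 + s\<^sup>2) + p * s = \<alpha>"
    and n3: "t * s + r * p = 1"
    using FK by (simp_all add: QK BK axis_def t_def s_def p_def r_def)
  define rot where "rot t s p r = (\<lambda>(v :: int \<Rightarrow> 'a) x. if x = 1 then t * v 1 + p * v (- 1)
    else if x = - 1 then r * v 1 + s * v (- 1) else v x)" for t s p r
  have A: "acts (x_A0 l t s p r) (rot t s p r)" for t s p r
    unfolding x_A0_def
    by (rule acts_cong, (rule acts_intros L1 | (simp add: rot_def algebra_simps)[1])+)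
  have ts: "s * t + p * r = 1" "r * p + s * t = 1" "t * s + p * r = 1" "r * p + t * s = 1"
    using n3 by (simp_all add: algebra_simps)
  \<comment> \<open>Exchanging the diagonal entries gives the adjugate, as signs do not matter in
    characteristic 2, and the determinant is 1 by \<open>n3\<close>.\<close>
  have inv: "rot s t p r (rot t s p r v) = v" "rot t s p r (rot s t p r v) = v" for v
  proof -
    have cancel: "x * (y * z) + y * (x * z) = 0" for x y z :: 'a
      using two by (simp add: mult.left_commute[of y] mult_2[symmetric])
    have "s * (t * v 1 + p * v (- 1)) + p * (r * v 1 + s * v (- 1)) = (t * s + r * p) * v 1 + (s * (p * v (- 1)) + p * (s * v (- 1)))"
      and "r * (t * v 1 + p * v (- 1)) + t * (r * v 1 + s * v (- 1)) = (t * s + r * p) * v (- 1) + (r * (t * v 1) + t * (r * v 1))"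
      and "t * (s * v 1 + p * v (- 1)) + p * (r * v 1 + t * v (- 1)) = (t * s + r * p) * v 1 + (t * (p * v (- 1)) + p * (t * v (- 1)))"
      and "r * (s * v 1 + p * v (- 1)) + s * (r * v 1 + t * v (- 1)) = (t * s + r * p) * v (- 1) + (r * (s * v 1) + s * (r * v 1))"
      by (simp_all add: algebra_simps)
    then show "rot s t p r (rot t s p r v) = v" "rot t s p r (rot s t p r v) = v"
      by (auto simp: rot_def n3 cancel)
  qed
  have "Qf (rot t s p r v) = Qf v" for v
  proof -
    \<comment> \<open>The coefficients are the values of the form at the two columns and of the
      polar form between them, that is, the left sides of \<open>n1\<close>, \<open>n2\<close> and
      \<open>n3\<close>.\<close>
    have "?Q (rot t s p r v) = (\<alpha> * (t\<^sup>2 + r\<^sup>2) + t * r) * (v 1)\<^sup>2 + (\<alpha> * (p\<^sup>2 + s\<^sup>2) + p * s) * (v (- 1))\<^sup>2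
        + (t * s + r * p) * (v 1 * v (- 1))"
      by (simp add: rot_def sq power_mult_distrib) (simp add: algebra_simps power2_eq_square)
    then have "?Q (rot t s p r v) = ?Q v" unfolding n1 n2 n3 by (simp add: algebra_simps)
    moreover have "(\<Sum>i\<in>?J. rot t s p r v i * rot t s p r v (- i)) = (\<Sum>i\<in>?J. v i * v (- i))"
      by (rule sum.cong) (auto simp: rot_def)
    ultimately show ?thesis unfolding Qf_def by (simp only:)
  qed
  then have "x_A0 l t s p r \<in> orth_group (2 * l) (Q_minus2 l \<alpha>)"
    by (rule orth_groupI[OF A A inv(2,1) q]) (auto simp: rot_def)
  then have "x_A0 l t s p r \<in> elem_O_minus2 l \<alpha>"
    using ts by (intro elem_O_minus2.x_A0) (auto simp: O_minus2_def)
  then have h: "gen (rot t s p r)" using A by (rule gen_elem)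
  define D where "D b x = (if b = int l then a else if b = - int l then inverse a else 1) * axis b x" for b x
  have "cmat F = cmat (\<lambda>b. rot t s p r (D b))"
  proof (rule cmat_cong)
    fix x b assume "x \<in> ?L" "b \<in> ?L"
    then consider "b = 1 \<or> b = - 1" | "b \<in> ?P" by blast
    then show "F b x = rot t s p r (D b) x"
    proof cases
      case 1
      have "int l \<noteq> 1" "- int l \<noteq> 1" "- 1 \<noteq> int l" "1 \<noteq> int l" "- 1 \<noteq> - int l" using assms(1) by auto
      then show ?thesis
        using 1 FK by (auto simp: rot_def D_def axis_def t_def s_def p_def r_def)
    next
      case 2
      then have "b \<noteq> 1" "b \<noteq> - 1" by auto
      then have "rot t s p r (D b) x = D b x" by (auto simp: rot_def D_def axis_def)
      then show ?thesis using F(5-7) 2 by (auto simp: D_def)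
    qed
  qed
  then have "\<exists>fs. set fs \<subseteq> elem_O_minus2 l \<alpha> \<and> g = mat_prod (2 * l) fs * cmat D"
    using gen_mult[OF h F(1)] F(2) by simp
  moreover have "cmat D = diag_minus l a"
    unfolding D_def cmat_diag diag_minus_def mat_diag_def
    by (rule cong_mat) (use L(1,2)[OF l] in \<open>auto simp: lab_eq_iff\<close>)
  ultimately show ?thesis using F(4) by metis
qed

section \<open>The symplectic group\<close>

locale symplectic_space = label_matrices d L pos E
  for d L pos and E :: "'a::field mat set" +
  fixes J :: "int set"
  assumes finite_J: "finite J"
    and J_pos: "\<And>i. i \<in> J \<Longrightarrow> i > 0"
    and L_eq: "L = J \<union> uminus ` J"
begin

definition Bs :: "(int \<Rightarrow> 'a) \<Rightarrow> (int \<Rightarrow> 'a) \<Rightarrow> 'a" where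
  "Bs v w = (\<Sum>i\<in>J. v i * w (- i) - v (- i) * w i)"

definition sgn_label :: "int \<Rightarrow> 'a" where
  "sgn_label c = (if c > 0 then 1 else - 1)"

sublocale reduction d L pos E J Bs "\<lambda>_. 0" sgn_label True
  by unfold_locales (use finite_J J_pos L_eq in auto)

lemma Bs_add: "Bs (\<lambda>x. u x + v x) w = Bs u w + Bs v w"
  by (simp add: Bs_def algebra_simps sum.distrib sum_subtractf)

lemma Bs_scale: "Bs (\<lambda>x. a * v x) w = a * Bs v w"
  by (simp add: Bs_def algebra_simps sum_distrib_left)

lemma Bs_anti: "Bs v w = - Bs w v"
  by (simp add: Bs_def sum_negf[symmetric] algebra_simps)

lemma Bs_self: "Bs v v = 0"
  by (simp add: Bs_def mult.commute)

lemma Bs_add_right: "Bs w (\<lambda>x. u x + v x) = Bs w u + Bs w v"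
  using Bs_add by (simp add: Bs_anti[of w])

lemma Bs_scale_right: "Bs w (\<lambda>x. a * v x) = a * Bs w v"
  using Bs_scale by (simp add: Bs_anti[of w])

lemma Bs_axis:
  assumes "c \<in> P"
  shows "Bs (axis c) v = sgn_label c * v (- c)"
proof (cases "c \<in> J")
  case True
  have "Bs (axis c) v = (\<Sum>i\<in>J. if i = c then v (- i) else 0)"
    unfolding Bs_def
  proof (rule sum.cong[OF refl])
    fix i assume "i \<in> J"
    then have "i > 0" "c > 0" using True J_pos by auto
    then show "axis c i * v (- i) - axis c (- i) * v i = (if i = c then v (- i) else 0)"
      by (auto simp: axis_def)
  qed
  then show ?thesis using True finite_J J_pos by (simp add: sgn_label_def)
next
  case False
  then have c: "- c \<in> J" using assms by auto
  have "Bs (axis c) v = (\<Sum>i\<in>J. if i = - c then - v i else 0)"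
    unfolding Bs_def by (rule sum.cong) (use False in \<open>auto simp: axis_def\<close>)
  then show ?thesis using c finite_J J_pos[OF c] by (simp add: sgn_label_def)
qed

lemma sgn_label_square [simp]: "sgn_label c * sgn_label c = 1"
  by (simp add: sgn_label_def)

lemma sgn_label_uminus: "c \<noteq> 0 \<Longrightarrow> sgn_label (- c) = - sgn_label c"
  by (auto simp: sgn_label_def)

text \<open>For \<open>c = - m\<close> the two entries of a root element fall on the same place and
  would add up to \<open>2 * t\<close>; the guard leaves the single entry of the long root
  element.\<close>

definition symp_shear :: "int \<Rightarrow> int \<Rightarrow> 'a \<Rightarrow> (int \<Rightarrow> 'a) \<Rightarrow> int \<Rightarrow> 'a" where
  "symp_shear c m t v = (\<lambda>x. v x + (if x = c then t * v m else 0)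
     - (if c \<noteq> - m \<and> x = - m then t * sgn_label c * sgn_label m * v (- c) else 0))"

text \<open>With \<open>e = axis c\<close> and \<open>f = axis (- m)\<close> the map adds
  \<open>k * (Bs f v * e + Bs e v * f)\<close>, or \<open>k * Bs f v * f\<close> if
  \<open>c = - m\<close>. As \<open>c\<close> differs from \<open>m\<close>, the form vanishes on
  the span of \<open>e\<close> and \<open>f\<close>, and the remaining terms cancel by
  antisymmetry.\<close>

lemma Bs_symp_shear:
  assumes "c \<in> P" "m \<in> P" "c \<noteq> m"
  shows "Bs (symp_shear c m t v) (symp_shear c m t w) = Bs v w"
proof -
  let ?f = "axis (- m) :: int \<Rightarrow> 'a" and ?e = "axis c :: int \<Rightarrow> 'a"
  define k where "k = - t * sgn_label m"
  have m: "- m \<in> P" "m \<noteq> 0" using assms(2) J_pos by force+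
  have vm: "u m = - sgn_label m * Bs ?f u" for u
    using Bs_axis[OF m(1), of u] m(2) sgn_label_square[of m]
    by (simp add: sgn_label_uminus mult.assoc[symmetric])
  have vc: "u (- c) = sgn_label c * Bs ?e u" for u
    using Bs_axis[OF assms(1), of u] sgn_label_square[of c] by (simp add: mult.assoc[symmetric])
  have ef: "Bs ?e ?f = 0" "Bs ?f ?e = 0"
    using Bs_axis[OF assms(1), of ?f] assms(3) Bs_anti[of ?f ?e] by (auto simp: axis_def)
  show ?thesis
  proof (cases "c = - m")
    case True
    have eq: "symp_shear c m t u = (\<lambda>x. u x + k * Bs ?f u * ?f x)" for u
      by (rule ext) (simp add: symp_shear_def True axis_def k_def vm[of u])
    show ?thesis
      unfolding eq Bs_add Bs_add_right Bs_scale Bs_scale_right Bs_self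
      by (simp add: Bs_anti[of v ?f])
  next
    case False
    have eq: "symp_shear c m t u = (\<lambda>x. (u x + k * Bs ?f u * ?e x) + k * Bs ?e u * ?f x)" for u
      using False by (intro ext) (simp add: symp_shear_def axis_def k_def vm[of u] vc[of u] mult_ac)
    show ?thesis
      unfolding eq Bs_add Bs_add_right Bs_scale Bs_scale_right Bs_self ef
      by (simp add: Bs_anti[of v ?f] Bs_anti[of v ?e] algebra_simps)
  qed
qed

lemma shear_symp_shear:
  assumes "c \<in> P" "m \<in> P" "c \<noteq> m" "gen (symp_shear c m (- t))"
  shows "shear c m t (symp_shear c m t)"
proof -
  have m: "m \<noteq> - m" "c \<noteq> - c" "- m \<in> L" "c \<in> L" using assms(1,2) J_pos L_eq by force+
  have "symp_shear c m (- t) (symp_shear c m t v) = v" for v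
    using m assms(3) by (intro ext) (auto simp: symp_shear_def)
  moreover have "symp_shear c m t v x = v x" if "x \<notin> L" for v x
    using that m by (auto simp: symp_shear_def)
  ultimately have "isom (symp_shear c m t)"
    unfolding isom_def using Bs_symp_shear[OF assms(1-3)] assms(4)
    by (intro conjI allI impI exI[of _ "symp_shear c m (- t)"] refl)
  moreover have "symp_shear c m t v = v" if "v m = 0" "v (- c) = 0" for v
    using that by (intro ext) (simp add: symp_shear_def)
  ultimately show ?thesis
    using assms(1) m unfolding shear_def by (intro conjI allI impI) (auto simp: symp_shear_def)
qed

end

locale symplectic_reduction = symplectic_space d L pos E J
  for d L pos and E :: "'a::field mat set" and J +
  assumes gen_symp_shear: "\<And>c m t. \<lbrakk>c \<in> P; m \<in> P; c \<noteq> m\<rbrakk> \<Longrightarrow> gen (symp_shear c m t)"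
begin

lemma ex_symp_shear: "c \<in> P \<Longrightarrow> m \<in> P \<Longrightarrow> c \<noteq> m \<Longrightarrow> shear c m t (symp_shear c m t)"
  using shear_symp_shear gen_symp_shear by blast

sublocale witt_reduction d L pos E J Bs "\<lambda>_. 0" sgn_label True
proof unfold_locales
  fix c m t assume "c \<in> L" "m \<in> P" "c \<noteq> m"
  then show "\<exists>h. shear c m t h"
    using ex_symp_shear[of c m t] L_eq by (intro exI[of _ "symp_shear c m t"]) simp
next
  fix m v w assume m: "m \<in> J" "v m = 0" and v: "\<And>x. x \<noteq> - m \<Longrightarrow> x \<notin> K \<Longrightarrow> v x = 0" and "Bs v w \<noteq> 0"
  have mP: "m \<in> P" "- m \<in> P" "m \<noteq> - m" using m J_pos[OF m(1)] by auto
  \<comment> \<open>\<open>K\<close> is empty, so \<open>v\<close> is supported on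
    \<open>- m\<close>, and the long root element with pivot \<open>- m\<close> carries this
    coordinate to \<open>m\<close>.\<close>
  have "v (- m) \<noteq> 0"
  proof
    assume "v (- m) = 0"
    then have "v x = 0" for x using v[of x] L_eq by (cases "x = - m") auto
    then have "Bs v w = 0" by (simp add: Bs_def)
    with \<open>Bs v w \<noteq> 0\<close> show False ..
  qed
  moreover have s: "shear m (- m) 1 (symp_shear m (- m) 1)"
    using ex_symp_shear mP by blast
  moreover have "fixes_off (insert m (insert (- m) K)) (symp_shear m (- m) 1)"
    unfolding fixes_off_def by (intro allI impI ext) (simp add: symp_shear_def)
  ultimately show "\<exists>h. isom h \<and> fixes_off (insert m (insert (- m) K)) h \<and> h v m \<noteq> 0"
    using m(2) by (intro exI[of _ "symp_shear m (- m) 1"]) (simp add: shear_def)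
qed (use Bs_axis Bs_scale in \<open>simp_all add: sgn_label_def\<close>)

end

section \<open>Symplectic matrices\<close>

lemma symp_form_index:
  assumes "k < 2 * l" "j < 2 * l"
  shows "symp_form l $$ (k, j) =
    (if k < l then if j = k + l then 1 else 0 else if k = j + l then - 1 else (0 :: 'a::field))"
  using assms by (auto simp: symp_form_def)

text \<open>Long root elements normalise the pivot even in the last pair, so elimination ends at the
  identity.\<close>

lemma Sp_decomposition:
  fixes g :: "'a::field mat"
  assumes "l \<ge> 1" "g \<in> Sp l"
  shows "\<exists>es. set es \<subseteq> elem_Sp l \<and> g = mat_prod (2 * l) es"
proof -
  note image_uminus_atLeastAtMost [simp del]
  let ?J = "{1..int l}"
  let ?L = "?J \<union> uminus ` ?J"
  have carrier: "elem_Sp l \<subseteq> (carrier_mat (2 * l) (2 * l) :: 'a mat set)"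
    by (auto elim!: elem_Sp.cases simp: mat_unit_def)
  interpret symplectic_space "2 * l" ?L "pos_even l" "elem_Sp l :: 'a mat set" ?J
    by unfold_locales (use bij_pos_even carrier in auto)
  have L: "i \<in> ?L" "- i \<in> ?L" "i > 0" if "i \<in> ?J" for i using that by auto
  have pp: "gen (symp_shear i j t)" if "i \<in> ?J" "j \<in> ?J" "i \<noteq> j" for i j t
    by (rule gen_elemI[OF elem_Sp.pos_pos[OF that, of t]],
        (rule acts_intros L(1,2)[OF that(1)] L(1,2)[OF that(2)]
          | (use that(3) L(3)[OF that(1)] L(3)[OF that(2)] in \<open>simp add: symp_shear_def sgn_label_def\<close>)[1])+)
  have pn: "gen (symp_shear i (- j) t)" if "i \<in> ?J" "j \<in> ?J" "i < j" for i j t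
    by (rule gen_elemI[OF elem_Sp.pos_neg[OF that, of t]],
        (rule acts_intros L(1,2)[OF that(1)] L(1,2)[OF that(2)]
          | (use that(3) L(3)[OF that(1)] L(3)[OF that(2)] in \<open>simp add: symp_shear_def sgn_label_def\<close>)[1])+)
  \<comment> \<open>The matrix is symmetric in \<open>i\<close> and \<open>j\<close>, so
    \<open>t\<close> is kept; in \<open>nn\<close> the two entries have opposite signs and the
    parameter becomes \<open>- t\<close>.\<close>
  have pn': "gen (symp_shear i (- j) t)" if "i \<in> ?J" "j \<in> ?J" "j < i" for i j t
    by (rule gen_elemI[OF elem_Sp.pos_neg[OF that(2,1,3), of t]],
        (rule acts_intros L(1,2)[OF that(1)] L(1,2)[OF that(2)]
          | (use that(3) L(3)[OF that(1)] L(3)[OF that(2)] in \<open>simp add: symp_shear_def sgn_label_def\<close>)[1])+)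
  have pn'': "gen (symp_shear i (- i) t)" if "i \<in> ?J" for i t
    by (rule gen_elemI[OF elem_Sp.pos_neg_same[OF that, of t]],
        (rule acts_intros L(1,2)[OF that(1)]
          | (use L(3)[OF that(1)] in \<open>simp add: symp_shear_def sgn_label_def\<close>)[1])+)
  have np: "gen (symp_shear (- i) j t)" if "i \<in> ?J" "j \<in> ?J" "i < j" for i j t
    by (rule gen_elemI[OF elem_Sp.neg_pos[OF that, of t]],
        (rule acts_intros L(1,2)[OF that(1)] L(1,2)[OF that(2)]
          | (use that(3) L(3)[OF that(1)] L(3)[OF that(2)] in \<open>simp add: symp_shear_def sgn_label_def\<close>)[1])+)
  have np': "gen (symp_shear (- i) j t)" if "i \<in> ?J" "j \<in> ?J" "j < i" for i j t
    by (rule gen_elemI[OF elem_Sp.neg_pos[OF that(2,1,3), of t]],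
        (rule acts_intros L(1,2)[OF that(1)] L(1,2)[OF that(2)]
          | (use that(3) L(3)[OF that(1)] L(3)[OF that(2)] in \<open>simp add: symp_shear_def sgn_label_def\<close>)[1])+)
  have np'': "gen (symp_shear (- i) i t)" if "i \<in> ?J" for i t
    by (rule gen_elemI[OF elem_Sp.neg_pos_same[OF that, of t]],
        (rule acts_intros L(1,2)[OF that(1)]
          | (use L(3)[OF that(1)] in \<open>simp add: symp_shear_def sgn_label_def\<close>)[1])+)
  have nn: "gen (symp_shear (- i) (- j) t)" if "i \<in> ?J" "j \<in> ?J" "i \<noteq> j" for i j t
    by (rule gen_elemI[OF elem_Sp.pos_pos[OF that(2,1) that(3)[symmetric], of "- t"]],
        (rule acts_intros L(1,2)[OF that(1)] L(1,2)[OF that(2)]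
          | (use that(3) L(3)[OF that(1)] L(3)[OF that(2)] in \<open>simp add: symp_shear_def sgn_label_def\<close>)[1])+)
  interpret symplectic_reduction "2 * l" ?L "pos_even l" "elem_Sp l :: 'a mat set" ?J
  proof unfold_locales
    fix c m t assume *: "c \<in> ?L" "m \<in> ?L" "c \<noteq> m"
    consider i j where "c = i" "m = j" "i \<in> ?J" "j \<in> ?J" | i j where "c = - i" "m = j" "i \<in> ?J" "j \<in> ?J"
      | i j where "c = i" "m = - j" "i \<in> ?J" "j \<in> ?J" | i j where "c = - i" "m = - j" "i \<in> ?J" "j \<in> ?J"
      using *(1,2) by blast
    then show "gen (symp_shear c m t)"
    proof cases
      case 1
      then show ?thesis using pp *(3) by simp
    next
      case (2 i j)
      then show ?thesis using np[of i j t] np'[of i j t] np''[of i t] by (cases i j rule: linorder_cases) simp_all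
    next
      case (3 i j)
      then show ?thesis using pn[of i j t] pn'[of i j t] pn''[of i t] by (cases i j rule: linorder_cases) simp_all
    next
      case 4
      then show ?thesis using nn *(3) by simp
    qed
  qed
  have form: "(transpose_mat x * symp_form l * x) $$ (pos_even l b, pos_even l c) = Bs (columns x b) (columns x c)"
    if x: "x \<in> carrier_mat (2 * l) (2 * l)" and bc: "b \<in> ?L" "c \<in> ?L" for x :: "'a mat" and b c
  proof -
    let ?r = "pos_even l b" and ?s = "pos_even l c"
    have rs: "?r < 2 * l" "?s < 2 * l" using pos_less bc by auto
    have \<beta>: "symp_form l \<in> (carrier_mat (2 * l) (2 * l) :: 'a mat set)"
      by (simp add: symp_form_def mult_2)
    \<comment> \<open>Each row of the form matrix has a single nonzero entry, \<open>l\<close>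
      places to the right or to the left of the diagonal.\<close>
    have row: "(symp_form l * x) $$ (k, ?s) = (if k < l then x $$ (k + l, ?s) else - x $$ (k - l, ?s))"
      if k: "k < 2 * l" for k
    proof -
      have "(symp_form l * x) $$ (k, ?s) = (\<Sum>j\<in>{0..<2 * l}. symp_form l $$ (k, j) * x $$ (j, ?s))"
        using k x \<beta> rs by (auto simp: scalar_prod_def)
      also have "\<dots> = (\<Sum>j\<in>{0..<2 * l}. if j = (if k < l then k + l else k - l)
          then (if k < l then x $$ (j, ?s) else - x $$ (j, ?s)) else 0)"
        by (rule sum.cong) (use k in \<open>auto simp: symp_form_index\<close>)
      also have "\<dots> = (if k < l then x $$ (k + l, ?s) else - x $$ (k - l, ?s))"
        using k by (auto simp: sum.delta)
      finally show ?thesis .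
    qed
    have "(transpose_mat x * symp_form l * x) $$ (?r, ?s) = (transpose_mat x * (symp_form l * x)) $$ (?r, ?s)"
      using x \<beta> by (subst assoc_mult_mat[of _ "2 * l" "2 * l" _ "2 * l" _ "2 * l"]) auto
    also have "\<dots> = (\<Sum>k\<in>{0..<2 * l}. x $$ (k, ?r) * (symp_form l * x) $$ (k, ?s))"
      using x \<beta> rs by (simp add: scalar_prod_def)
    also have "\<dots> = (\<Sum>k\<in>{0..<2 * l}. x $$ (k, ?r) * (if k < l then x $$ (k + l, ?s) else - x $$ (k - l, ?s)))"
      by (rule sum.cong) (use row in auto)
    \<comment> \<open>Position \<open>k\<close> below \<open>l\<close> carries the label
      \<open>k + 1\<close> and position \<open>k + l\<close> its negative, so shifting the second
      half by \<open>l\<close> matches the two halves label by label.\<close>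
    also have "\<dots> = (\<Sum>k\<in>{0..<l}. x $$ (k, ?r) * x $$ (k + l, ?s))
        + (\<Sum>k\<in>{0 + l..<l + l}. x $$ (k, ?r) * - x $$ (k - l, ?s))"
      by (subst sum.atLeastLessThan_concat[of 0 l "2 * l", symmetric]) (auto simp: mult_2 intro!: arg_cong2[where f = "(+)"] sum.cong)
    also have "\<dots> = (\<Sum>k\<in>{0..<l}. x $$ (k, ?r) * x $$ (k + l, ?s) - x $$ (k + l, ?r) * x $$ (k, ?s))"
      unfolding sum.shift_bounds_nat_ivl by (simp add: sum_negf sum_subtractf)
    also have "\<dots> = Bs (columns x b) (columns x c)"
      unfolding Bs_def
      by (rule sum.reindex_bij_witness[where i = "\<lambda>i. nat i - 1" and j = "\<lambda>k. int k + 1"])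
        (auto simp: columns_def pos_even_def nat_add_distrib algebra_simps)
    finally show ?thesis .
  qed
  have g: "g \<in> carrier_mat (2 * l) (2 * l)" "transpose_mat g * symp_form l * g = symp_form l"
    using assms(2) by (auto simp: Sp_def GL_def)
  have "Bs (columns g b) (columns g c) = Bs (axis b) (axis c)" if "b \<in> ?L" "c \<in> ?L" for b c
  proof -
    have one: "columns (1\<^sub>m (2 * l)) a = axis a" if "a \<in> ?L" for a
      using that pos_less pos_eq_iff by (intro ext) (auto simp: columns_def axis_def)
    have "symp_form l \<in> (carrier_mat (2 * l) (2 * l) :: 'a mat set)"
      by (simp add: symp_form_def mult_2)
    then have "transpose_mat (1\<^sub>m (2 * l)) * symp_form l * 1\<^sub>m (2 * l) = (symp_form l :: 'a mat)"
      by simp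
    then show ?thesis using form[OF g(1) that] form[OF one_carrier_mat that] g(2) one that by simp
  qed
  then have "iso_family (columns g)" by (simp add: iso_family_def columns_def)
  moreover have "int l \<in> ?J" using assms by simp
  ultimately have "int l \<in> ?J" "iso_family (columns g)" by simp_all
  from reduce[OF this] obtain es F a where F: "set es \<subseteq> elem_Sp l" "cmat (columns g) = mat_prod (2 * l) es * cmat F"
    "iso_family F" "a \<noteq> 0" "True \<longrightarrow> a = 1" "\<forall>b\<in>?L - {int l, - int l}. F b = axis b"
    "F (int l) = (\<lambda>x. a * axis (int l) x)" "F (- int l) = (\<lambda>x. inverse a * axis (- int l) x)"
    by (elim exE conjE) (rule that)
  have "cmat F = cmat axis"
  proof (rule cmat_cong)
    fix x b assume "b \<in> ?L"
    then consider "b = int l" | "b = - int l" | "b \<in> ?L - {int l, - int l}" by blast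
    then show "F b x = axis b x" by cases (use F(5-8) in simp_all)
  qed
  then have "g = mat_prod (2 * l) es * 1\<^sub>m (2 * l)"
    using F(2) cmat_columns[OF g(1)] by (simp add: cmat_axis)
  moreover have "mat_prod (2 * l) es \<in> carrier_mat (2 * l) (2 * l)"
    using F(1) carrier by (intro mat_prod_carrier) auto
  ultimately show ?thesis using F(1) by (intro exI[of _ es]) simp
qed

theorem theoremA:
  fixes l :: nat
  assumes "l \<ge> 2"
  shows
    "(\<forall>g \<in> (O_plus l :: 'a::field mat set). \<exists>es c.
        set es \<subseteq> elem_O_plus l \<and> c \<noteq> 0 \<and> g = mat_prod (2 * l) es * diag_plus l c)
     \<and> (\<forall>g \<in> (O_odd l :: 'a mat set). \<exists>es \<theta> c.
        set es \<subseteq> elem_O_odd l \<and> c \<noteq> 0 \<and> (\<theta> = 1 \<or> \<theta> = - 1)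
        \<and> g = mat_prod (2 * l + 1) es * diag_odd l \<theta> c)
     \<and> (\<forall>\<epsilon> :: 'a. CHAR('a) \<noteq> 2 \<longrightarrow> \<not> is_square \<epsilon> \<longrightarrow>
        (\<forall>g \<in> O_minus l \<epsilon>. \<exists>es c.
           set es \<subseteq> elem_O_minus l \<epsilon> \<and> c \<noteq> 0 \<and> g = mat_prod (2 * l) es * diag_minus l c))
     \<and> (\<forall>\<alpha> :: 'a. CHAR('a) = 2 \<longrightarrow> irreducible [:\<alpha>, 1, \<alpha>:] \<longrightarrow>
        (\<forall>g \<in> O_minus2 l \<alpha>. \<exists>es c.
           set es \<subseteq> elem_O_minus2 l \<alpha> \<and> c \<noteq> 0 \<and> g = mat_prod (2 * l) es * diag_minus l c))
     \<and> (\<forall>g \<in> (Sp l :: 'a mat set). \<exists>es.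
        set es \<subseteq> elem_Sp l \<and> g = mat_prod (2 * l) es)"
proof (intro conjI ballI allI impI)
  have l: "l \<ge> 1" using assms by simp
  show "\<exists>es c. set es \<subseteq> elem_O_plus l \<and> c \<noteq> 0 \<and> g = mat_prod (2 * l) es * diag_plus l c"
    if "g \<in> O_plus l" for g :: "'a mat"
    using O_plus_decomposition[OF l that] .
  show "\<exists>es \<theta> c. set es \<subseteq> elem_O_odd l \<and> c \<noteq> 0 \<and> (\<theta> = 1 \<or> \<theta> = - 1)
      \<and> g = mat_prod (2 * l + 1) es * diag_odd l \<theta> c" if "g \<in> O_odd l" for g :: "'a mat"
    using O_odd_decomposition[OF l that] .
  show "\<exists>es c. set es \<subseteq> elem_O_minus l \<epsilon> \<and> c \<noteq> 0 \<and> g = mat_prod (2 * l) es * diag_minus l c"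
    if "CHAR('a) \<noteq> 2" "\<not> is_square \<epsilon>" "g \<in> O_minus l \<epsilon>" for \<epsilon> and g :: "'a mat"
  proof -
    have "\<epsilon> \<noteq> 0" using that(2) by (auto simp: is_nth_power_def)
    then show ?thesis using O_minus_decomposition[OF assms that(1) _ that(3)] by blast
  qed
  show "\<exists>es c. set es \<subseteq> elem_O_minus2 l \<alpha> \<and> c \<noteq> 0 \<and> g = mat_prod (2 * l) es * diag_minus l c"
    if "CHAR('a) = 2" "g \<in> O_minus2 l \<alpha>" for \<alpha> and g :: "'a mat"
    using O_minus2_decomposition[OF assms that] .
  show "\<exists>es. set es \<subseteq> elem_Sp l \<and> g = mat_prod (2 * l) es" if "g \<in> Sp l" for g :: "'a mat"
    using Sp_decomposition[OF l that] .
qed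

end
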